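(* Let $n\geq 2$, and let $A,Z$ be two compact subsets of the sphere $\mathbb{S}^n$ that admit nested bases $\mathcal{B}^A,\mathcal{B}^Z$, respectively, consisting of open metric balls of $\mathbb{S}^n$. Let $h: A \to Z$ be a homeomorphism. Then there is a homeomorphism $h'$ from $\mathbb{S}^n$ onto itself extending $h$ (that is, $h'|_A = h$). Moreover, $h'$ can be chosen to be orientation reversing, and it can also be chosen to be orientation preserving.
   Context: $\mathbb{S}^n$ denotes the standard $n$-dimensional sphere with its standard metric $d$; $A$ and $Z$ carry the subspace topology. An open metric ball of a metric space $(Y,d)$ is a set of the form $B_r(x)= \{y \in Y \mid d(x,y)<r \}$ with $x\in Y$, $r>0$. A set $\mathcal{U}$ of open subsets of a topological space $Y$ is called nested if for every $U,V\in \mathcal{U}$ we have either $\overline{U} \cap \overline{V} = \emptyset$, or $U\subseteq V$, or $V\subseteq U$ (closures taken in $Y$). For $X \subseteq \mathbb{S}^n$, a nested basis of $X$ consisting of open metric balls of $\mathbb{S}^n$ is a nested set $\mathcal{B}$ of open metric balls of $\mathbb{S}^n$ (nested as open subsets of $\mathbb{S}^n$) such that the restrictions $\{U \cap X \mid U \in \mathcal{B}\}$ form a basis of the topology of $X$. *)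

theory Defs
  imports "HOL-Analysis.Analysis" "HOL-Homology.Homology"
begin

section \<open>The standard metric on the sphere\<close>

text \<open>
  The points of \<^term>\<open>nsphere n\<close> are sequences supported on the indices up to \<open>n\<close>, so
  \<open>sphere_dist n\<close> is the Euclidean (chordal) distance of the ambient space of dimension \<open>n + 1\<close>.
  The angular distance has the same open balls, with different radii
  (lemma \<open>ball_on_sphere_iff_angular\<close> below), so nothing depends on which of the two is taken as the
  standard metric.
\<close>

definition sphere_dist :: "nat \<Rightarrow> (nat \<Rightarrow> real) \<Rightarrow> (nat \<Rightarrow> real) \<Rightarrow> real" where
  "sphere_dist n x y = sqrt (\<Sum>i\<le>n. (x i - y i)\<^sup>2)"

definition angular_dist :: "nat \<Rightarrow> (nat \<Rightarrow> real) \<Rightarrow> (nat \<Rightarrow> real) \<Rightarrow> real" where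
  "angular_dist n x y = arccos (\<Sum>i\<le>n. x i * y i)"

definition ball_on_sphere :: "nat \<Rightarrow> (nat \<Rightarrow> real) set \<Rightarrow> bool" where
  "ball_on_sphere n U \<longleftrightarrow>
    (\<exists>x\<in>topspace (nsphere n). \<exists>r>0.
       U = Metric_space.mball (topspace (nsphere n)) (sphere_dist n) x r)"


section \<open>Nested bases\<close>

definition nested_in :: "'a topology \<Rightarrow> 'a set set \<Rightarrow> bool" where
  "nested_in Y \<U> \<longleftrightarrow>
    (\<forall>U\<in>\<U>. openin Y U) \<and>
    (\<forall>U\<in>\<U>. \<forall>V\<in>\<U>. Y closure_of U \<inter> Y closure_of V = {} \<or> U \<subseteq> V \<or> V \<subseteq> U)"

text \<open>The analogue of \<^const>\<open>topological_basis\<close> for an abstract topology.\<close>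

definition basis_of_topology :: "'a topology \<Rightarrow> 'a set set \<Rightarrow> bool" where
  "basis_of_topology X B \<longleftrightarrow>
    (\<forall>U\<in>B. openin X U) \<and> (\<forall>U. openin X U \<longrightarrow> (\<exists>B'\<subseteq>B. \<Union>B' = U))"

definition nested_ball_basis :: "nat \<Rightarrow> (nat \<Rightarrow> real) set \<Rightarrow> (nat \<Rightarrow> real) set set \<Rightarrow> bool" where
  "nested_ball_basis n X \<B> \<longleftrightarrow>
    (\<forall>U\<in>\<B>. ball_on_sphere n U) \<and>
    nested_in (nsphere n) \<B> \<and>
    basis_of_topology (subtopology (nsphere n) X) {U \<inter> X | U. U \<in> \<B>}"


section \<open>Orientation\<close>

text \<open>
  \<^term>\<open>Brouwer_degree2 n f\<close> is the integer by which \<open>f\<close> acts on the reduced homology of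
  \<^term>\<open>nsphere n\<close> in dimension \<open>n\<close>; for a homeomorphism it is 1 or -1.
\<close>

definition orientation_preserving :: "nat \<Rightarrow> ((nat \<Rightarrow> real) \<Rightarrow> nat \<Rightarrow> real) \<Rightarrow> bool" where
  "orientation_preserving n f \<longleftrightarrow>
    homeomorphic_map (nsphere n) (nsphere n) f \<and> Brouwer_degree2 n f = 1"

definition orientation_reversing :: "nat \<Rightarrow> ((nat \<Rightarrow> real) \<Rightarrow> nat \<Rightarrow> real) \<Rightarrow> bool" where
  "orientation_reversing n f \<longleftrightarrow>
    homeomorphic_map (nsphere n) (nsphere n) f \<and> Brouwer_degree2 n f = -1"


section \<open>Basic facts on the metric\<close>

lemma topspace_nsphere_iff:
  "x \<in> topspace (nsphere n) \<longleftrightarrow> (\<Sum>i\<le>n. (x i)\<^sup>2) = 1 \<and> (\<forall>i>n. x i = 0)"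
  by (simp add: nsphere)

lemma Metric_space_sphere: "Metric_space (topspace (nsphere n)) (sphere_dist n)"
proof
  fix x y z :: "nat \<Rightarrow> real"
  show "0 \<le> sphere_dist n x y"
    by (simp add: sphere_dist_def sum_nonneg)
  show "sphere_dist n x y = sphere_dist n y x"
    by (simp add: sphere_dist_def power2_commute)
  assume x: "x \<in> topspace (nsphere n)" and y: "y \<in> topspace (nsphere n)"
  have "(\<forall>i\<le>n. x i = y i) \<longleftrightarrow> x = y"
    using x y unfolding topspace_nsphere_iff by (metis ext not_le)
  then show "sphere_dist n x y = 0 \<longleftrightarrow> x = y"
    by (simp add: sphere_dist_def sum_nonneg_eq_0_iff Ball_def)
  show "sphere_dist n x z \<le> sphere_dist n x y + sphere_dist n y z"
    using L2_set_triangle_ineq[of "\<lambda>i. x i - y i" "\<lambda>i. y i - z i" "{..n}"]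
    by (simp add: sphere_dist_def L2_set_def)
qed

lemma sphere_inner_bounds:
  assumes "x \<in> topspace (nsphere n)" "y \<in> topspace (nsphere n)"
  shows "sphere_dist n x y = sqrt (2 - 2 * (\<Sum>i\<le>n. x i * y i))"
    and "(\<Sum>i\<le>n. x i * y i) \<in> {-1..1}"
proof -
  let ?c = "\<Sum>i\<le>n. x i * y i"
  have s: "(\<Sum>i\<le>n. (x i)\<^sup>2) = 1" "(\<Sum>i\<le>n. (y i)\<^sup>2) = 1"
    using assms by (auto simp: topspace_nsphere_iff)
  have m: "(\<Sum>i\<le>n. (x i - y i)\<^sup>2) = 2 - 2 * ?c"
    by (simp add: power2_diff sum.distrib sum_subtractf s sum_distrib_left mult.assoc)
  have p: "(\<Sum>i\<le>n. (x i + y i)\<^sup>2) = 2 + 2 * ?c"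
    by (simp add: power2_sum sum.distrib s sum_distrib_left mult.assoc)
  show "sphere_dist n x y = sqrt (2 - 2 * ?c)"
    by (simp add: sphere_dist_def m)
  have "0 \<le> 2 - 2 * ?c" "0 \<le> 2 + 2 * ?c"
    unfolding m[symmetric] p[symmetric] by (auto intro: sum_nonneg)
  then show "?c \<in> {-1..1}"
    by simp
qed

lemma sphere_chord_less_iff:
  fixes c r :: real
  assumes "c \<in> {-1..1}" "0 < r" "r \<le> pi"
  shows "arccos c < r \<longleftrightarrow> sqrt (2 - 2 * c) < sqrt (2 - 2 * cos r)"
proof -
  have "arccos c < r \<longleftrightarrow> cos r < cos (arccos c)"
    using assms by (intro cos_mono_less_eq[symmetric]) (auto intro: arccos_lbound arccos_ubound)
  then show ?thesis
    using assms by simp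
qed

lemma ball_on_sphere_iff_angular:
  "ball_on_sphere n U \<longleftrightarrow>
    (\<exists>x\<in>topspace (nsphere n). \<exists>r>0. U = {y \<in> topspace (nsphere n). angular_dist n x y < r})"
proof -
  let ?S = "topspace (nsphere n)"
  have ball: "ball_on_sphere n U \<longleftrightarrow> (\<exists>x\<in>?S. \<exists>r>0. U = {y \<in> ?S. sphere_dist n x y < r})"
    unfolding ball_on_sphere_def Metric_space.mball_def[OF Metric_space_sphere]
    by (intro bex_cong refl) auto
  have less_iff: "angular_dist n x y < r \<longleftrightarrow> sphere_dist n x y < sqrt (2 - 2 * cos r)"
    if "x \<in> ?S" "y \<in> ?S" "0 < r" "r \<le> pi" for x y r
    using sphere_chord_less_iff[OF sphere_inner_bounds(2)[OF that(1,2)] that(3,4)]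
      sphere_inner_bounds(1)[OF that(1,2)] by (simp add: angular_dist_def)
  have le_pi: "angular_dist n x y \<le> pi" if "x \<in> ?S" "y \<in> ?S" for x y
    using sphere_inner_bounds(2)[OF that] by (simp add: angular_dist_def arccos_ubound)
  have le_2: "sphere_dist n x y \<le> 2" if "x \<in> ?S" "y \<in> ?S" for x y
    using sphere_inner_bounds[OF that] by (simp add: real_le_lsqrt)
  show ?thesis
    unfolding ball
  proof (intro bex_cong refl iffI; elim exE conjE)
    fix x r assume x: "x \<in> ?S" and r: "0 < (r::real)" and U: "U = {y \<in> ?S. sphere_dist n x y < r}"
    show "\<exists>r>0. U = {y \<in> ?S. angular_dist n x y < r}"
    proof (cases "r \<le> 2")
      case True
      define t where "t = arccos (1 - r\<^sup>2 / 2)"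
      have r4: "r\<^sup>2 \<le> 4"
        using power_mono[OF True, of 2] r by simp
      have t: "0 \<le> t" "t \<le> pi" "cos t = 1 - r\<^sup>2 / 2"
        using r4 by (auto simp: t_def arccos_lbound arccos_ubound)
      have "t \<noteq> 0"
        using t(3) r by auto
      moreover have "sqrt (2 - 2 * cos t) = r"
        using t(3) r by simp
      ultimately have "U = {y \<in> ?S. angular_dist n x y < t}"
        using U less_iff[OF x _ _ t(2)] t(1) by auto
      then show ?thesis
        using t(1) \<open>t \<noteq> 0\<close> by (intro exI[of _ t]) auto
    next
      case False
      have "U = {y \<in> ?S. angular_dist n x y < pi + 1}"
        using U False le_2[OF x] le_pi[OF x] by force
      then show ?thesis
        by (intro exI[of _ "pi + 1"]) (auto simp: add_pos_pos)
    qed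
  next
    fix x r assume x: "x \<in> ?S" and r: "0 < (r::real)" and U: "U = {y \<in> ?S. angular_dist n x y < r}"
    show "\<exists>r>0. U = {y \<in> ?S. sphere_dist n x y < r}"
    proof (cases "r \<le> pi")
      case True
      have "cos r < cos 0"
        using r True by (intro cos_monotone_0_pi) auto
      then have "0 < sqrt (2 - 2 * cos r)"
        by simp
      moreover have "U = {y \<in> ?S. sphere_dist n x y < sqrt (2 - 2 * cos r)}"
        using U less_iff[OF x _ r True] by auto
      ultimately show ?thesis
        by blast
    next
      case False
      have "U = {y \<in> ?S. sphere_dist n x y < 3}"
        using U False le_2[OF x] le_pi[OF x] by force
      then show ?thesis
        by (intro exI[of _ 3]) auto
    qed
  qed
qed

end

theory Submission
  imports Defs
begin

text \<open>
  A point outside \<open>A \<union> Z\<close> exists because both sets have empty interior; project the sphere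
  stereographically from it onto a Euclidean space \<open>H\<close>. Two caps missing a common point become
  convex sets in a suitable stereographic chart, so their intersection is star-shaped about each of
  its points and a homeomorphism supported in it pushes any compact subset into a prescribed small
  neighbourhood. The maximal balls of a nested basis, cut down to small balls, therefore give finite
  disjoint covers of \<open>A\<close> by arbitrarily small sets with this squeezing property.
  Composing with such squeezings, an arbitrarily small perturbation of any homeomorphism makes
  the first coordinate separate points of \<open>A\<close> that are at least \<open>\<epsilon>\<close> apart, and a Baire category
  argument yields a homeomorphism after which the coordinate is injective on \<open>A\<close>. A shear then moves \<open>A\<close>
  into a line of \<open>H\<close>. Once \<open>A\<close> and \<open>Z\<close> lie on two orthogonal lines, Klee's trick with
  two further shears extends the homeomorphism. A reflection that fixes the line containing
  the flattened \<open>A\<close> changes the orientation.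
\<close>


section \<open>Stereographic projection\<close>

text \<open>A nested basis controls only the traces \<open>U \<inter> A\<close>: the ball
  \<open>U\<close> itself may be huge, so a map supported in \<open>U\<close> need not be a small
  perturbation. Cutting \<open>U\<close> down to a small ball repairs this without losing points of
  \<open>A\<close>, but the intersection of two caps can be an annulus when together they cover the
  sphere. A point of \<open>A\<close> far from the small ball lies in neither cap, and projecting
  from it makes both convex. This pole changes from piece to piece, whereas the pole of the
  coordinate to be made injective is chosen once and fixed by all maps. All perturbations are
  precompositions \<open>f \<circ> F\<close> with \<open>F\<close> preserving each piece. The
  inverse then changes from \<open>g\<close> to \<open>G \<circ> g\<close>, which is as close to
  \<open>g\<close> as the pieces are small, so limits of maps and of inverses exist together.
  Dimension at least two enters because \<open>H\<close> must contain two orthogonal lines; the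
  second one also supplies the vector of the reflection.\<close>

definition stereo :: "'a::real_inner \<Rightarrow> 'a \<Rightarrow> 'a" where
  "stereo q x = (1 / (1 - x \<bullet> q)) *\<^sub>R (x - (x \<bullet> q) *\<^sub>R q)"

definition unstereo :: "'a::real_inner \<Rightarrow> 'a \<Rightarrow> 'a" where
  "unstereo q v = (1 / (v \<bullet> v + 1)) *\<^sub>R ((v \<bullet> v - 1) *\<^sub>R q + 2 *\<^sub>R v)"

lemma inner_unstereo:
  fixes v q c :: "'a::real_inner"
  shows "unstereo q v \<bullet> c = ((v \<bullet> v - 1) * (q \<bullet> c) + 2 * (v \<bullet> c)) / (v \<bullet> v + 1)"
  by (simp add: unstereo_def inner_add_left)

lemma inner_self_plus_one_pos: "0 < v \<bullet> v + (1::real)"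
  by (simp add: add_nonneg_pos)

lemma continuous_unstereo: "continuous_on X (unstereo q)"
  unfolding unstereo_def by (intro continuous_intros ballI less_imp_neq[THEN not_sym] inner_self_plus_one_pos)

text \<open>Here \<open>V\<close> may sit in an infinite-dimensional space; compactness of its unit
  sphere plays the part of finite dimension. \<open>H\<close> is the chart of the sphere minus
  \<open>q\<close>.\<close>

locale pole =
  fixes V :: "'a::real_inner set" and q :: 'a
  assumes subV: "subspace V" and q: "q \<in> V" "norm q = 1" and comp: "compact {x \<in> V. norm x = 1}"
begin

abbreviation "S \<equiv> {x \<in> V. norm x = 1}"
abbreviation "H \<equiv> {v \<in> V. v \<bullet> q = 0}"

lemma inner_q_q [simp]: "q \<bullet> q = 1"
  using q by (simp add: norm_eq_1)

lemma subH: "subspace H"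
  using subV by (auto simp: subspace_def inner_add_left)

lemma dist_q: "x \<in> S \<Longrightarrow> (norm (x - q))\<^sup>2 = 2 - 2 * (x \<bullet> q)"
  by (simp add: power2_norm_eq_inner inner_diff_left inner_diff_right norm_eq_1 inner_commute)

lemma inner_q_less: "x \<in> S \<Longrightarrow> x \<noteq> q \<Longrightarrow> x \<bullet> q < 1"
  using dist_q[of x] by (smt (verit) zero_less_norm_iff right_minus_eq zero_less_power)

lemma unstereo_S:
  assumes "v \<in> H" shows "unstereo q v \<in> S"
proof -
  have "unstereo q v \<in> V"
    using assms q subV unfolding unstereo_def by (auto intro!: subspace_add subspace_scale)
  moreover have "unstereo q v \<bullet> unstereo q v = 1"
  proof -
    have "unstereo q v \<bullet> unstereo q v = ((v \<bullet> v - 1)\<^sup>2 + 4 * (v \<bullet> v)) / (v \<bullet> v + 1)\<^sup>2"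
    proof -
      have a: "v \<bullet> q = 0" "q \<bullet> v = 0" using assms by (auto simp: inner_commute)
      show ?thesis by (simp add: unstereo_def inner_add_left inner_add_right a power2_eq_square add_divide_distrib)
    qed
    also have "\<dots> = 1"
    proof -
      have "(v \<bullet> v - 1)\<^sup>2 + 4 * (v \<bullet> v) = (v \<bullet> v + 1)\<^sup>2" by (simp add: power2_eq_square algebra_simps)
      then show ?thesis using inner_self_plus_one_pos[of v] by simp
    qed
    finally show ?thesis .
  qed
  ultimately show ?thesis by (simp add: norm_eq_1)
qed

lemma unstereo_inner_q: "v \<in> H \<Longrightarrow> unstereo q v \<bullet> q = 1 - 2 / (v \<bullet> v + 1)"
  using inner_self_plus_one_pos[of v] by (simp add: inner_unstereo field_simps)

lemma unstereo_neq: "v \<in> H \<Longrightarrow> unstereo q v \<noteq> q"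
  using unstereo_inner_q[of v] inner_self_plus_one_pos[of v] by force

lemma stereo_H: "x \<in> S \<Longrightarrow> stereo q x \<in> H"
  using q subV unfolding stereo_def
  by (auto intro!: subspace_add subspace_diff subspace_scale simp: inner_diff_left)

lemma stereo_unstereo:
  assumes "v \<in> H" shows "stereo q (unstereo q v) = v"
proof -
  let ?d = "v \<bullet> v + 1"
  have d: "?d > 0" by (rule inner_self_plus_one_pos)
  have "unstereo q v - (1 - 2 / ?d) *\<^sub>R q = (2 / ?d) *\<^sub>R v"
  proof -
    have "(v \<bullet> v - 1) / ?d = 1 - 2 / ?d" using d by (simp add: field_simps)
    then show ?thesis by (simp add: unstereo_def scaleR_add_right)
  qed
  moreover have "1 / (1 - (1 - 2 / ?d)) * (2 / ?d) = 1" using d by simp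
  ultimately show ?thesis
    unfolding stereo_def unstereo_inner_q[OF assms] by (simp only: scaleR_scaleR scaleR_one)
qed

lemma unstereo_inj: "v \<in> H \<Longrightarrow> w \<in> H \<Longrightarrow> unstereo q v = unstereo q w \<Longrightarrow> v = w"
  using stereo_unstereo by metis

lemma inner_stereo: "stereo q x \<bullet> w = (x \<bullet> w - (x \<bullet> q) * (q \<bullet> w)) / (1 - x \<bullet> q)"
  by (simp add: stereo_def inner_diff_left)

lemma norm_stereo:
  assumes "x \<in> S" "x \<noteq> q"
  shows "stereo q x \<bullet> stereo q x + 1 = 2 / (1 - x \<bullet> q)"
proof -
  have x: "x \<bullet> x = 1" "1 - x \<bullet> q > 0" using assms inner_q_less by (auto simp: norm_eq_1)
  have "stereo q x \<bullet> stereo q x = (1 - (x \<bullet> q)\<^sup>2) / (1 - x \<bullet> q)\<^sup>2"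
    unfolding stereo_def by (simp add: inner_diff_left inner_diff_right x inner_commute power2_eq_square)
  also have "\<dots> = (1 + x \<bullet> q) / (1 - x \<bullet> q)"
  proof -
    have "1 - (x \<bullet> q)\<^sup>2 = (1 - x \<bullet> q) * (1 + x \<bullet> q)" by (simp add: power2_eq_square algebra_simps)
    then show ?thesis using x by (simp add: power2_eq_square)
  qed
  finally show ?thesis using x by (simp add: field_simps)
qed

lemma unstereo_stereo:
  assumes "x \<in> S" "x \<noteq> q"
  shows "unstereo q (stereo q x) = x"
proof -
  have x: "1 - x \<bullet> q > 0" using assms inner_q_less by auto
  have a: "stereo q x \<bullet> stereo q x = 2 / (1 - x \<bullet> q) - 1"
    using norm_stereo[OF assms] by simp
  have b: "(1 - x \<bullet> q) / 2 * (2 / (1 - x \<bullet> q) - 1 - 1) = x \<bullet> q"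
    using x by (simp add: field_simps)
  have "unstereo q (stereo q x) = ((1 - x \<bullet> q) / 2) *\<^sub>R ((2 / (1 - x \<bullet> q) - 1 - 1) *\<^sub>R q + 2 *\<^sub>R stereo q x)"
    unfolding unstereo_def a by simp
  also have "\<dots> = (x \<bullet> q) *\<^sub>R q + (1 - x \<bullet> q) *\<^sub>R stereo q x"
    unfolding scaleR_add_right scaleR_scaleR b by simp
  also have "\<dots> = x" using x by (simp add: stereo_def)
  finally show ?thesis .
qed

lemma continuous_stereo: "continuous_on (S - {q}) (stereo q)"
  unfolding stereo_def using inner_q_less
  by (intro continuous_intros) fastforce

text \<open>Neighbourhoods of \<open>q\<close> correspond to complements of large balls of
  \<open>H\<close>, so continuity at the pole becomes a growth condition in the chart.\<close>

lemma dist_unstereo_q: "v \<in> H \<Longrightarrow> (norm (unstereo q v - q))\<^sup>2 = 4 / (v \<bullet> v + 1)"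
  using dist_q[OF unstereo_S] unstereo_inner_q[of v] by simp

text \<open>Properness keeps points near infinity near infinity, which is continuity at
  \<open>q\<close> once \<open>q\<close> is fixed. The inverse is continuous because a continuous
  bijection of a compact Hausdorff space is a homeomorphism.\<close>

lemma extend_over_pole:
  assumes T: "continuous_on H T" "bij_betw T H H"
    and proper: "\<And>B. \<exists>B'. \<forall>v\<in>H. B' \<le> norm v \<longrightarrow> B \<le> norm (T v)"
  obtains f g where "homeomorphism S S f g" "f q = q" "\<And>v. v \<in> H \<Longrightarrow> f (unstereo q v) = unstereo q (T v)"
proof -
  define f where "f x = (if x = q then q else unstereo q (T (stereo q x)))" for x
  have TH: "T v \<in> H" if "v \<in> H" for v
    using bij_betw_imp_surj_on[OF T(2)] that by blast
  have fu: "f (unstereo q v) = unstereo q (T v)" if "v \<in> H" for v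
    using that by (simp add: f_def unstereo_neq stereo_unstereo)
  have rep: "x = q \<or> (\<exists>v\<in>H. x = unstereo q v)" if "x \<in> S" for x
    using stereo_H[OF that] unstereo_stereo[OF that] by force
  have qS: "q \<in> S" using q by simp
  have fS: "f x \<in> S" if "x \<in> S" for x
    using rep[OF that]
  proof
    assume "x = q" then show ?thesis using qS by (simp add: f_def)
  next
    assume "\<exists>v\<in>H. x = unstereo q v"
    then obtain v where "v \<in> H" "x = unstereo q v" by blast
    then show ?thesis using fu TH unstereo_S by auto
  qed
  have inj: "inj_on f S"
  proof (rule inj_onI)
    fix x y assume xy: "x \<in> S" "y \<in> S" "f x = f y"
    have a: "f q = q" by (simp add: f_def)
    have b: "f (unstereo q v) \<noteq> q" if "v \<in> H" for v
      using fu[OF that] unstereo_neq[OF TH[OF that]] by simp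
    have c: "v = w" if "v \<in> H" "w \<in> H" "f (unstereo q v) = f (unstereo q w)" for v w
    proof -
      have "unstereo q (T v) = unstereo q (T w)" unfolding fu[OF that(1), symmetric] fu[OF that(2), symmetric] by (rule that(3))
      then have "T v = T w" by (rule unstereo_inj[OF TH[OF that(1)] TH[OF that(2)]])
      then show ?thesis using inj_onD[OF bij_betw_imp_inj_on[OF T(2)]] that(1,2) by blast
    qed
    show "x = y"
    proof (cases "x = q")
      case True
      then have fy: "f y = q" using xy(3) a by simp
      then have "y \<noteq> unstereo q v" if "v \<in> H" for v using b[OF that] by metis
      then show ?thesis using rep[OF xy(2)] True by blast
    next
      case False
      then obtain v where v: "v \<in> H" "x = unstereo q v" using rep[OF xy(1)] by blast
      then have "y \<noteq> q" using xy(3) a b[OF v(1)] by metis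
      then obtain w where w: "w \<in> H" "y = unstereo q w" using rep[OF xy(2)] by blast
      then show ?thesis using c[OF v(1) w(1)] v xy(3) by simp
    qed
  qed
  have surj: "f ` S = S"
  proof
    show "f ` S \<subseteq> S" using fS by auto
    show "S \<subseteq> f ` S"
    proof
      fix y assume "y \<in> S"
      then consider "y = q" | v where "v \<in> H" "y = unstereo q v" using rep by blast
      then show "y \<in> f ` S"
      proof cases
        case 1
        then show ?thesis using qS by (auto simp: f_def image_iff)
      next
        case 2
        then have "v \<in> T ` H" using bij_betw_imp_surj_on[OF T(2)] by blast
        then obtain w where "w \<in> H" "T w = v" by blast
        then have "y = f (unstereo q w)" "unstereo q w \<in> S" using 2(2) fu unstereo_S by auto
        then show ?thesis by blast
      qed
    qed
  qed
  have cont: "continuous_on S f"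
    unfolding continuous_on_eq_continuous_within
  proof
    fix x assume x: "x \<in> S"
    show "continuous (at x within S) f"
    proof (cases "x = q")
      case True
      have "\<exists>d>0. \<forall>y\<in>S. norm (y - q) < d \<longrightarrow> norm (f y - q) < e" if "e > 0" for e
      proof -
        \<comment> \<open>By \<open>dist_unstereo_q\<close>, chart norm at least
          \<open>2 / e\<close> means chordal distance below \<open>e\<close> from \<open>q\<close>;
          \<open>d\<close> below is the distance from \<open>q\<close> of chart points whose norm is
          the absolute value of \<open>B'\<close>.\<close>
        obtain B' where B': "\<And>v. v \<in> H \<Longrightarrow> B' \<le> norm v \<Longrightarrow> 2 / e \<le> norm (T v)"
          using proper[of "2 / e"] by blast
        define d where "d = 2 / sqrt (B'\<^sup>2 + 1)"
        have B1: "B'\<^sup>2 + 1 > 0" by (simp add: add_nonneg_pos)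
        then have d: "d > 0" by (simp add: d_def)
        have "norm (f y - q) < e" if y: "y \<in> S" "norm (y - q) < d" for y
        proof (cases "y = q")
          case True then show ?thesis using \<open>e > 0\<close> by (simp add: f_def)
        next
          case False
          then obtain v where v: "v \<in> H" "y = unstereo q v" using rep y(1) by blast
          have "4 / (v \<bullet> v + 1) < d\<^sup>2"
            using dist_unstereo_q[OF v(1)] y(2) v(2) by (metis power_strict_mono norm_ge_zero pos2)
          also have "d\<^sup>2 = 4 / (B'\<^sup>2 + 1)" using B1 by (simp add: d_def power_divide)
          finally have "B'\<^sup>2 + 1 < v \<bullet> v + 1"
            using B1 inner_self_plus_one_pos[of v] by (simp add: divide_less_eq field_simps)
          then have "\<bar>B'\<bar> \<le> norm v" by (simp add: norm_eq_sqrt_inner real_le_rsqrt)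
          then have "2 / e \<le> norm (T v)" using B'[OF v(1)] by simp
          then have "(2 / e)\<^sup>2 \<le> T v \<bullet> T v"
            using \<open>e > 0\<close> by (metis power2_norm_eq_inner power_mono divide_nonneg_pos zero_le_numeral)
          then have "4 / e\<^sup>2 < T v \<bullet> T v + 1" by (simp add: power_divide)
          then have "4 / (T v \<bullet> T v + 1) < e\<^sup>2"
            using \<open>e > 0\<close> inner_self_plus_one_pos[of "T v"] by (simp add: field_simps)
          then have "(norm (f y - q))\<^sup>2 < e\<^sup>2"
            using dist_unstereo_q[OF TH[OF v(1)]] fu[OF v(1)] v(2) by simp
          then show ?thesis using \<open>e > 0\<close> by (simp add: power_less_imp_less_base)
        qed
        then show ?thesis using d by blast
      qed
      then show ?thesis unfolding True continuous_within_eps_delta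
        by (auto simp: dist_norm f_def)
    next
      case False
      have "continuous_on (S - {q}) f"
      proof (rule continuous_on_eq)
        have "stereo q ` (S - {q}) \<subseteq> H" using stereo_H by blast
        then show "continuous_on (S - {q}) (unstereo q \<circ> (T \<circ> stereo q))"
          by (intro continuous_on_compose continuous_unstereo continuous_stereo continuous_on_subset[OF T(1)])
      qed (auto simp: f_def)
      moreover have "at x within (S - {q}) = at x within S"
        using False by (auto intro!: at_within_nhd[of x "- {q}"])
      moreover have "x \<in> S - {q}" using x False by blast
      ultimately show ?thesis
        unfolding continuous_on_eq_continuous_within by force
    qed
  qed
  obtain g where "homeomorphism S S f g"
    using homeomorphism_compact[OF comp cont surj inj] by blast
  then show thesis using that fu by (simp add: f_def)
qed

end

section \<open>Squeezing compact sets inside caps\<close>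

text \<open>\<open>T\<close> contracts towards \<open>p\<close> along rays, by the constant factor
  \<open>d\<close> where \<open>F\<close> is at most \<open>m\<close> and by a factor rising to 1 as
  \<open>F\<close> rises to 0. By convexity \<open>F\<close> does not decrease along a ray from
  \<open>p\<close> once it exceeds \<open>m \<ge> F p\<close>; hence the factor is monotone and no
  two points of a ray collide.\<close>

lemma squeeze_convex:
  fixes F :: "'a::real_normed_vector \<Rightarrow> real"
  assumes H: "subspace H" and F: "convex_on UNIV F" "continuous_on UNIV F"
    and p: "p \<in> H" "F p < 0" and K: "compact K" "K \<subseteq> H" "\<And>v. v \<in> K \<Longrightarrow> F v < 0" and "0 < e"
  obtains T where "continuous_on H T" "bij_betw T H H"
    "\<And>B. \<exists>B'. \<forall>v\<in>H. B' \<le> norm v \<longrightarrow> B \<le> norm (T v)"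
    "\<And>v. 0 \<le> F v \<Longrightarrow> T v = v" "\<And>v. v \<in> K \<Longrightarrow> norm (T v - p) < e"
proof -
  \<comment> \<open>Including \<open>p\<close> gives \<open>F p \<le> m\<close>, on which
    monotonicity along rays rests, and a maximum even for empty \<open>K\<close>.\<close>
  have "compact (insert p K)" using K by simp
  moreover have "continuous_on (insert p K) F" using F(2) continuous_on_subset by blast
  ultimately obtain u where u: "u \<in> insert p K" "\<And>v. v \<in> insert p K \<Longrightarrow> F v \<le> F u"
    using continuous_attains_sup[of "insert p K" F] by blast
  define m where "m = F u"
  have m: "m < 0" "F p \<le> m" "\<And>v. v \<in> K \<Longrightarrow> F v \<le> m"
    using u p K(3) by (auto simp: m_def)
  obtain R where R: "R > 0" "\<And>v. v \<in> K \<Longrightarrow> norm (v - p) \<le> R"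
  proof -
    have "bounded ((\<lambda>v. v - p) ` K)" using K(1) by (intro compact_imp_bounded compact_continuous_image continuous_intros)
    then show thesis using that by (auto simp: bounded_pos)
  qed
  \<comment> \<open>\<open>d * R < e\<close> fits the contracted \<open>K\<close> into the
    \<open>e\<close>-ball about \<open>p\<close>; the bound \<open>1/2\<close> keeps the factor
    below 1.\<close>
  define d where "d = min (1/2) (e / (2 * R))"
  have d: "0 < d" "d < 1" using \<open>e > 0\<close> R by (auto simp: d_def)
  have "d * R \<le> e / (2 * R) * R" using R by (intro mult_right_mono) (auto simp: d_def)
  then have dR: "d * R < e" using R \<open>e > 0\<close> by simp
  define c where "c v = max 0 (min 1 ((F v - m) / (- m)))" for v
  define l where "l v = d + (1 - d) * c v" for v
  define T where "T v = p + l v *\<^sub>R (v - p)" for v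
  have c: "0 \<le> c v" "c v \<le> 1" for v by (auto simp: c_def)
  have l: "d \<le> l v" "l v \<le> 1" for v
  proof -
    have "0 \<le> (1 - d) * c v" "(1 - d) * c v \<le> (1 - d) * 1" using c[of v] d by (simp, intro mult_left_mono) auto
    then show "d \<le> l v" "l v \<le> 1" by (auto simp: l_def)
  qed
  have l1: "l v = 1" if "0 \<le> F v" for v
    using that m by (simp add: l_def c_def min_def divide_simps)
  have ld: "l v = d" if "F v \<le> m" for v
  proof -
    have "(F v - m) / (- m) \<le> 0" using that m by (intro divide_nonpos_pos) auto
    then show ?thesis by (simp add: l_def c_def)
  qed
  have mono: "l (p + w) \<le> l (p + t *\<^sub>R w)" if "1 \<le> t" for t w
  proof (cases "F (p + w) \<le> m")
    case True
    then show ?thesis using ld l by simp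
  next
    case False
    have "p + w = (1 - 1/t) *\<^sub>R p + (1/t) *\<^sub>R (p + t *\<^sub>R w)" using that by (simp add: algebra_simps)
    then have "F (p + w) \<le> (1 - 1/t) * F p + (1/t) * F (p + t *\<^sub>R w)"
      using convex_onD[OF F(1), of "1/t" p "p + t *\<^sub>R w"] that by simp
    also have "\<dots> \<le> (1 - 1/t) * F (p + w) + (1/t) * F (p + t *\<^sub>R w)"
      using False m that by (intro add_right_mono mult_left_mono) auto
    finally have "F (p + w) \<le> F (p + t *\<^sub>R w)" using that by (simp add: field_simps)
    then have "(F (p + w) - m) / (- m) \<le> (F (p + t *\<^sub>R w) - m) / (- m)"
      using m by (intro divide_right_mono) auto
    then have "c (p + w) \<le> c (p + t *\<^sub>R w)" unfolding c_def by linarith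
    then show ?thesis using d by (simp add: l_def mult_left_mono)
  qed
  have contl: "continuous_on X l" for X
    unfolding l_def c_def using m by (intro continuous_intros continuous_on_subset[OF F(2)]) auto
  have contT: "continuous_on X T" for X
    unfolding T_def by (intro continuous_intros contl)
  have TH: "T v \<in> H" if "v \<in> H" for v
    unfolding T_def using that p H by (intro subspace_add subspace_scale subspace_diff) auto
  have inj0: "t = 1" if "T (p + w) = T (p + t *\<^sub>R w)" "1 \<le> t" "w \<noteq> 0" for t w
  proof -
    have "(l (p + w)) *\<^sub>R w = (l (p + t *\<^sub>R w) * t) *\<^sub>R w" using that(1) by (simp add: T_def)
    then have e: "l (p + w) = l (p + t *\<^sub>R w) * t" using that(3) by simp
    also have "\<dots> \<ge> l (p + w) * t" using mono[OF that(2)] that(2) by (intro mult_right_mono) auto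
    finally have "l (p + w) * t \<le> l (p + w) * 1" by simp
    then show ?thesis using l[of "p + w"] d that(2) by simp
  qed
  have inj: "inj_on T H"
  proof (rule inj_onI)
    fix v v' assume "T v = T v'"
    then have e: "l v *\<^sub>R (v - p) = l v' *\<^sub>R (v' - p)" by (simp add: T_def)
    have wlog: "v = v'" if le: "l v' \<le> l v" and e: "l v *\<^sub>R (v - p) = l v' *\<^sub>R (v' - p)" for v v'
    proof (cases "v = p")
      case True
      then show ?thesis using e l[of v'] d by simp
    next
      case False
      define t where "t = l v / l v'"
      have lp: "l v' > 0" using l[of v'] d by linarith
      have t: "1 \<le> t" using le lp by (simp add: t_def)
      have "t *\<^sub>R (v - p) = (1 / l v') *\<^sub>R (l v *\<^sub>R (v - p))" by (simp add: t_def)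
      also have "\<dots> = v' - p" unfolding e using lp by simp
      finally have v': "v' = p + t *\<^sub>R (v - p)" by simp
      have "T (p + (v - p)) = T (p + t *\<^sub>R (v - p))"
        unfolding v'[symmetric] using e by (simp add: T_def)
      then have "t = 1" using inj0[of "v - p" t] t False by simp
      then show ?thesis using v' by simp
    qed
    show "v = v'" using wlog[of v v'] wlog[of v' v] e by (metis linear)
  qed
  have surj: "T ` H = H"
  proof
    show "T ` H \<subseteq> H" using TH by auto
    show "H \<subseteq> T ` H"
    proof
      fix y assume y: "y \<in> H"
      define w where "w = y - p"
      \<comment> \<open>The factor \<open>l\<close> lies between \<open>d\<close> and 1, so the
        preimage of \<open>y\<close> on its ray has a parameter between 1 and
        \<open>1 / d\<close>.\<close>
      have "\<exists>t\<ge>1. t \<le> 1/d \<and> t * l (p + t *\<^sub>R w) = 1"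
      proof (rule IVT')
        show "1 * l (p + 1 *\<^sub>R w) \<le> 1" using l by simp
        show "1 \<le> 1/d * l (p + (1/d) *\<^sub>R w)" using l d by (simp add: le_divide_eq)
        show "1 \<le> 1/d" using d by simp
        have "continuous_on {1..1/d} (l \<circ> (\<lambda>t. p + t *\<^sub>R w))"
          by (intro continuous_on_compose continuous_intros contl)
        then show "continuous_on {1..1/d} (\<lambda>t. t * l (p + t *\<^sub>R w))"
          by (intro continuous_intros) (simp add: o_def)
      qed
      then obtain t where t: "t * l (p + t *\<^sub>R w) = 1" by blast
      have "T (p + t *\<^sub>R w) = y"
        using t by (simp add: T_def mult.commute w_def)
      moreover have "p + t *\<^sub>R w \<in> H"
        unfolding w_def using y p H by (intro subspace_add subspace_scale subspace_diff) auto
      ultimately show "y \<in> T ` H" by force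
    qed
  qed
  have proper: "\<exists>B'. \<forall>v\<in>H. B' \<le> norm v \<longrightarrow> B \<le> norm (T v)" for B
  proof (intro exI ballI impI)
    fix v :: 'a assume v: "(B + norm p) / d + norm p \<le> norm v"
    have "norm v - norm p \<le> norm (v - p)" by (rule norm_triangle_ineq2)
    then have "(B + norm p) / d \<le> norm (v - p)" using v by linarith
    then have "B + norm p \<le> d * norm (v - p)" using d by (simp add: divide_le_eq mult.commute)
    also have "\<dots> \<le> l v * norm (v - p)" using l by (intro mult_right_mono) auto
    also have "\<dots> = norm (T v - p)" using l[of v] d by (simp add: T_def)
    also have "\<dots> \<le> norm (T v) + norm p" by (rule norm_triangle_ineq4)
    finally show "B \<le> norm (T v)" by simp
  qed
  show thesis
  proof (rule that[OF contT _ proper])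
    show "bij_betw T H H" using inj surj by (simp add: bij_betw_def)
    show "T v = v" if "0 \<le> F v" for v using l1[OF that] by (simp add: T_def)
    show "norm (T v - p) < e" if "v \<in> K" for v
    proof -
      have "norm (T v - p) = d * norm (v - p)" using ld[OF m(3)[OF that]] d by (simp add: T_def)
      also have "\<dots> \<le> d * R" using R(2)[OF that] d by (intro mult_left_mono) auto
      finally show ?thesis using dR by simp
    qed
  qed
qed

section \<open>Caps as convex sublevel sets in the chart\<close>

lemma convex_on_quadratic:
  fixes c :: "'a::real_inner"
  assumes "0 \<le> a"
  shows "convex_on UNIV (\<lambda>v. a * (v \<bullet> v) - 2 * (c \<bullet> v) + b)"
proof (intro convex_onI)
  fix t :: real and x y :: 'a
  assume t: "0 < t" "t < 1"
  let ?z = "(1 - t) *\<^sub>R x + t *\<^sub>R y"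
  have "?z \<bullet> ?z = (1 - t) * (x \<bullet> x) + t * (y \<bullet> y) - t * (1 - t) * ((x - y) \<bullet> (x - y))"
    by (simp add: inner_add_left inner_add_right inner_diff_left inner_diff_right inner_commute algebra_simps)
  also have "\<dots> \<le> (1 - t) * (x \<bullet> x) + t * (y \<bullet> y)" using t by simp
  finally have "a * (?z \<bullet> ?z) \<le> a * ((1 - t) * (x \<bullet> x) + t * (y \<bullet> y))"
    using assms by (rule mult_left_mono)
  then show "a * (?z \<bullet> ?z) - 2 * (c \<bullet> ?z) + b
      \<le> (1 - t) * (a * (x \<bullet> x) - 2 * (c \<bullet> x) + b) + t * (a * (y \<bullet> y) - 2 * (c \<bullet> y) + b)"
    by (simp add: inner_add_right algebra_simps)
qed simp

lemma convex_on_max2: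
  fixes f g :: "'a::real_vector \<Rightarrow> real"
  assumes "convex_on A f" "convex_on A g"
  shows "convex_on A (\<lambda>x. max (f x) (g x))"
proof (intro convex_onI)
  fix t x y assume t: "0 < (t::real)" "t < 1" and xy: "x \<in> A" "y \<in> A"
  have "f ((1 - t) *\<^sub>R x + t *\<^sub>R y) \<le> (1 - t) * f x + t * f y"
       "g ((1 - t) *\<^sub>R x + t *\<^sub>R y) \<le> (1 - t) * g x + t * g y"
    using assms t xy by (auto intro: convex_onD)
  moreover have "(1 - t) * f x \<le> (1 - t) * max (f x) (g x)" "(1 - t) * g x \<le> (1 - t) * max (f x) (g x)"
       "t * f y \<le> t * max (f y) (g y)" "t * g y \<le> t * max (f y) (g y)" using t by auto
  ultimately show "max (f ((1 - t) *\<^sub>R x + t *\<^sub>R y)) (g ((1 - t) *\<^sub>R x + t *\<^sub>R y))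
      \<le> (1 - t) * max (f x) (g x) + t * max (f y) (g y)" by linarith
qed (use assms convex_on_imp_convex in blast)

context pole begin

text \<open>The pole lies outside both caps. The inequality defining such a cap, multiplied by the
  positive denominator of \<open>unstereo\<close>, is a convex quadratic inequality in the chart,
  and the intersection of the two caps is a strict sublevel set of the maximum.\<close>

lemma squeeze_caps:
  assumes c: "c1 \<bullet> q \<le> t1" "c2 \<bullet> q \<le> t2" and p: "p \<in> S" "t1 < c1 \<bullet> p" "t2 < c2 \<bullet> p"
    and K: "compact K" "K \<subseteq> S" "\<And>x. x \<in> K \<Longrightarrow> t1 < c1 \<bullet> x \<and> t2 < c2 \<bullet> x" and N: "open N" "p \<in> N"
  obtains s r where "homeomorphism S S s r"
    "\<And>x. x \<in> S \<Longrightarrow> \<not> (t1 < c1 \<bullet> x \<and> t2 < c2 \<bullet> x) \<Longrightarrow> s x = x" "s ` K \<subseteq> N"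
proof -
  \<comment> \<open>\<open>G c t v\<close> is
    \<open>(v \<bullet> v + 1) * (t - c \<bullet> unstereo q v)\<close>; its leading coefficient is
    nonnegative exactly when \<open>q\<close> is not in the cap.\<close>
  define G where "G c t v = (t - c \<bullet> q) * (v \<bullet> v) - 2 * (c \<bullet> v) + (t + c \<bullet> q)" for c v :: 'a and t :: real
  define F where "F v = max (G c1 t1 v) (G c2 t2 v)" for v
  have G: "G c t v < 0 \<longleftrightarrow> t < c \<bullet> unstereo q v" for c v t
  proof -
    have "t < c \<bullet> unstereo q v \<longleftrightarrow> t * (v \<bullet> v + 1) < (v \<bullet> v - 1) * (q \<bullet> c) + 2 * (v \<bullet> c)"
      unfolding inner_commute[of c "unstereo q v"] inner_unstereo
      using inner_self_plus_one_pos[of v] by (simp add: less_divide_eq)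
    then show ?thesis by (simp add: G_def inner_commute algebra_simps)
  qed
  have convG: "convex_on UNIV (\<lambda>v. G c t v)" if "c \<bullet> q \<le> t" for c t
    unfolding G_def using that by (intro convex_on_quadratic) auto
  have F1: "convex_on UNIV F" unfolding F_def by (intro convex_on_max2 convG c)
  have F2: "continuous_on UNIV F" unfolding F_def G_def by (intro continuous_intros)
  have F: "F v < 0 \<longleftrightarrow> t1 < c1 \<bullet> unstereo q v \<and> t2 < c2 \<bullet> unstereo q v" for v
    using G by (simp add: F_def)
  have pq: "p \<noteq> q" using c p by auto
  have Kq: "q \<notin> K" using c K(3)[of q] by auto
  let ?p = "stereo q p" and ?K = "stereo q ` K"
  have p': "?p \<in> H" "F ?p < 0" "unstereo q ?p = p"
    using stereo_H[OF p(1)] unstereo_stereo[OF p(1) pq] p F by auto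
  have K': "compact ?K" "?K \<subseteq> H" "\<And>v. v \<in> ?K \<Longrightarrow> F v < 0"
  proof -
    have "K \<subseteq> S - {q}" using K Kq by auto
    then show "compact ?K" using K(1) continuous_stereo
      by (meson compact_continuous_image continuous_on_subset)
    show "?K \<subseteq> H" using stereo_H K(2) by blast
    fix v assume "v \<in> ?K"
    then obtain x where x: "x \<in> K" "v = stereo q x" by blast
    then have "x \<in> S" "x \<noteq> q" using K(2) Kq by auto
    then show "F v < 0" using F K(3)[OF x(1)] x(2) unstereo_stereo by simp
  qed
  have "open (unstereo q -` N)" using open_vimage[OF N(1)] continuous_unstereo by blast
  moreover have "?p \<in> unstereo q -` N" using p' N by simp
  ultimately obtain e where e: "e > 0" "\<And>v. norm (v - ?p) < e \<Longrightarrow> unstereo q v \<in> N"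
    unfolding open_dist dist_norm by blast
  obtain T where T: "continuous_on H T" "bij_betw T H H"
    "\<And>B. \<exists>B'. \<forall>v\<in>H. B' \<le> norm v \<longrightarrow> B \<le> norm (T v)"
    "\<And>v. 0 \<le> F v \<Longrightarrow> T v = v" "\<And>v. v \<in> ?K \<Longrightarrow> norm (T v - ?p) < e"
    using squeeze_convex[OF subH F1 F2 p'(1,2) K' e(1)] by blast
  obtain s r where sr: "homeomorphism S S s r" "s q = q" "\<And>v. v \<in> H \<Longrightarrow> s (unstereo q v) = unstereo q (T v)"
    using extend_over_pole[OF T(1,2,3)] by blast
  have sx: "s x = unstereo q (T (stereo q x))" if "x \<in> S" "x \<noteq> q" for x
    using sr(3)[OF stereo_H[OF that(1)]] unstereo_stereo[OF that] by simp
  show thesis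
  proof (rule that[OF sr(1)])
    fix x assume x: "x \<in> S" "\<not> (t1 < c1 \<bullet> x \<and> t2 < c2 \<bullet> x)"
    show "s x = x"
    proof (cases "x = q")
      case True then show ?thesis using sr(2) by simp
    next
      case False
      have "0 \<le> F (stereo q x)" using F[of "stereo q x"] x unstereo_stereo[OF x(1) False] by (metis not_le)
      then show ?thesis using sx[OF x(1) False] T(4) unstereo_stereo[OF x(1) False] by simp
    qed
  next
    show "s ` K \<subseteq> N"
    proof
      fix y assume "y \<in> s ` K"
      then obtain x where x: "x \<in> K" "y = s x" by blast
      then have "x \<in> S" "x \<noteq> q" using K(2) Kq by auto
      then show "y \<in> N" using x sx e(2) T(5) by simp
    qed
  qed
qed

end

section \<open>Disjoint covers by squeezable sets\<close>

lemma homeomorphism_support: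
  assumes "homeomorphism S S f g" "D \<subseteq> S" "\<And>x. x \<in> S - D \<Longrightarrow> f x = x"
  shows "x \<in> D \<Longrightarrow> f x \<in> D" "x \<in> D \<Longrightarrow> g x \<in> D" "x \<in> S - D \<Longrightarrow> g x = x"
proof -
  have fg: "\<And>x. x \<in> S \<Longrightarrow> f x \<in> S" "\<And>x. x \<in> S \<Longrightarrow> g x \<in> S" "\<And>x. x \<in> S \<Longrightarrow> g (f x) = x" "\<And>x. x \<in> S \<Longrightarrow> f (g x) = x"
    using assms(1) by (auto simp: homeomorphism_def)
  show 1: "x \<in> S - D \<Longrightarrow> g x = x" for x
    using assms(3) fg(3) by (metis DiffD1)
  show "f x \<in> D" if "x \<in> D" for x
  proof (rule ccontr)
    assume "f x \<notin> D"
    moreover have "f x \<in> S" using that assms(2) fg(1) by blast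
    ultimately have "g (f x) = f x" using 1 by blast
    then show False using that assms(2) fg(3) \<open>f x \<notin> D\<close> by (metis subsetD)
  qed
  show "g x \<in> D" if "x \<in> D" for x
  proof (rule ccontr)
    assume "g x \<notin> D"
    moreover have "g x \<in> S" using that assms(2) fg(2) by blast
    ultimately have "f (g x) = g x" using assms(3) by blast
    then show False using that assms(2) fg(4) \<open>g x \<notin> D\<close> by (metis subsetD)
  qed
qed

text \<open>As the supports are disjoint, the composition of all \<open>s D\<close> acts on each
  piece as its own map. That \<open>g\<close> preserves the pieces too is recorded in order to bound
  the displacement of the inverse by the size of the pieces.\<close>

lemma glue_homeomorphisms:
  assumes "finite J" "disjoint J" "\<And>D. D \<in> J \<Longrightarrow> D \<subseteq> S"
    and "\<And>D. D \<in> J \<Longrightarrow> homeomorphism S S (s D) (r D)"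
    and "\<And>D x. D \<in> J \<Longrightarrow> x \<in> S - D \<Longrightarrow> s D x = x"
  shows "\<exists>f g. homeomorphism S S f g \<and> (\<forall>D\<in>J. \<forall>x\<in>D. f x = s D x \<and> f x \<in> D \<and> g x \<in> D) \<and>
    (\<forall>x\<in>S - \<Union>J. f x = x \<and> g x = x)"
  using assms
proof (induction J rule: finite_induct)
  case empty
  show ?case using homeomorphism_ident by (intro exI[of _ "\<lambda>x. x"]) auto
next
  case (insert E J)
  have dis: "D \<inter> E = {}" if "D \<in> J" for D
    using insert.prems(1) insert.hyps(2) that by (auto simp: disjoint_def)
  obtain f g where fg: "homeomorphism S S f g" "\<And>D x. D \<in> J \<Longrightarrow> x \<in> D \<Longrightarrow> f x = s D x \<and> f x \<in> D \<and> g x \<in> D"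
    "\<And>x. x \<in> S - \<Union>J \<Longrightarrow> f x = x \<and> g x = x"
  proof -
    have "disjoint J" using insert.prems(1) by (auto simp: disjoint_def)
    from insert.IH[OF this insert.prems(2,3,4)] obtain f g where
      fg: "homeomorphism S S f g" "\<forall>D\<in>J. \<forall>x\<in>D. f x = s D x \<and> f x \<in> D \<and> g x \<in> D" "\<forall>x\<in>S - \<Union>J. f x = x \<and> g x = x"
      by auto
    show thesis using that[OF fg(1)] fg(2,3) by blast
  qed
  have hE: "homeomorphism S S (s E) (r E)" "E \<subseteq> S" "\<And>x. x \<in> S - E \<Longrightarrow> s E x = x" using insert.prems by auto
  note sE = homeomorphism_support[OF hE]
  have DS: "D \<subseteq> S" if "D \<in> J" for D using insert.prems(2) that by auto
  have 1: "(f \<circ> s E) x = s E x \<and> (f \<circ> s E) x \<in> E \<and> (r E \<circ> g) x \<in> E" if "x \<in> E" for x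
  proof -
    have "s E x \<in> E" "r E x \<in> E" using sE that by auto
    moreover have "y \<in> S - \<Union>J" if "y \<in> E" for y using that dis hE(2) by blast
    ultimately show ?thesis using fg(3) that by simp
  qed
  have 2: "(f \<circ> s E) x = s D x \<and> (f \<circ> s E) x \<in> D \<and> (r E \<circ> g) x \<in> D" if "D \<in> J" "x \<in> D" for D x
  proof -
    have "y \<in> S - E" if "y \<in> D" for y using dis DS that \<open>D \<in> J\<close> by blast
    then have "s E x = x" "r E (g x) = g x" using hE(3) sE(3) fg(2)[OF that] that(2) by blast+
    then show ?thesis using fg(2)[OF that] by (metis comp_apply)
  qed
  have 3: "(f \<circ> s E) x = x \<and> (r E \<circ> g) x = x" if "x \<in> S - \<Union>(insert E J)" for x
    using that fg(3)[of x] hE(3)[of x] sE(3)[of x] by simp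
  have "homeomorphism S S (f \<circ> s E) (r E \<circ> g)" by (rule homeomorphism_compose[OF hE(1) fg(1)])
  then show ?case using 1 2 3 by (intro exI[of _ "f \<circ> s E"] exI[of _ "r E \<circ> g"]) blast
qed

text \<open>Greedy choice: the finitely many values already taken never exhaust an infinite set. It
  gives the pieces of a cover pairwise different target coordinates.\<close>

lemma inj_choice_infinite:
  assumes "finite J" "\<And>j. j \<in> J \<Longrightarrow> infinite (I j)"
  shows "\<exists>t. inj_on t J \<and> (\<forall>j\<in>J. t j \<in> I j)"
  using assms
proof (induction J rule: finite_induct)
  case (insert a J)
  then obtain t where t: "inj_on t J" "\<forall>j\<in>J. t j \<in> I j" by auto
  have "infinite (I a - t ` J)" using insert by simp
  then obtain b where "b \<in> I a - t ` J" by (metis ex_in_conv finite.emptyI)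
  then show ?case using t insert.hyps(2)
    by (intro exI[of _ "t(a := b)"]) (auto simp: inj_on_def)
qed auto

text \<open>The target \<open>p\<close> may be any point of \<open>D\<close>; this freedom lets
  different pieces be squeezed to places with prescribed, different coordinates.\<close>

definition squeezable :: "'a::metric_space set \<Rightarrow> 'a set \<Rightarrow> 'a set \<Rightarrow> bool" where
  "squeezable S A D \<longleftrightarrow> (\<forall>p\<in>D. \<forall>N. open N \<longrightarrow> p \<in> N \<longrightarrow>
     (\<exists>s r. homeomorphism S S s r \<and> (\<forall>x\<in>S - D. s x = x) \<and> s ` (A \<inter> D) \<subseteq> N))"

definition cap :: "'a::real_inner set \<Rightarrow> 'a \<Rightarrow> real \<Rightarrow> 'a set" where
  "cap S c t = {x \<in> S. t < c \<bullet> x}"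

text \<open>Half-space sections instead of metric balls make membership linear in the point, which
  suits the chart computation; the basis condition appears as arbitrarily small traces on
  \<open>A\<close>.\<close>

definition cap_basis :: "'a::real_inner set \<Rightarrow> 'a set \<Rightarrow> 'a set set \<Rightarrow> bool" where
  "cap_basis S A \<B> \<longleftrightarrow> (\<forall>U\<in>\<B>. \<exists>c t. U = cap S c t) \<and>
     (\<forall>U\<in>\<B>. \<forall>W\<in>\<B>. U \<inter> W = {} \<or> U \<subseteq> W \<or> W \<subseteq> U) \<and>
     (\<forall>a\<in>A. \<forall>e>0. \<exists>U\<in>\<B>. a \<in> U \<and> U \<inter> A \<subseteq> ball a e)"

lemma openin_cap: "openin (top_of_set S) (cap S c t)"
proof -
  have "open {x. t < c \<bullet> x}" by (intro open_Collect_less continuous_intros)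
  moreover have "cap S c t = S \<inter> {x. t < c \<bullet> x}" by (auto simp: cap_def)
  ultimately show ?thesis by (metis openin_open_Int)
qed

lemma maximal_members_cover:
  assumes "finite \<U>" "a \<in> \<Union>\<U>"
  shows "\<exists>M\<in>\<U>. a \<in> M \<and> (\<forall>W\<in>\<U>. M \<subseteq> W \<longrightarrow> W = M)"
proof -
  obtain U where U: "U \<in> \<U>" "a \<in> U" using assms by auto
  from finite_has_maximal2[OF assms(1) U(1)]
  obtain M where M: "M \<in> \<U>" "U \<subseteq> M" "\<forall>W\<in>\<U>. M \<subseteq> W \<longrightarrow> M = W" by (elim bexE conjE)
  show ?thesis
  proof (intro bexI conjI)
    show "a \<in> M" using M(2) U(2) by (rule subsetD)
    show "\<forall>W\<in>\<U>. M \<subseteq> W \<longrightarrow> W = M" using M(3) by auto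
  qed (rule M(1))
qed

text \<open>Nestedness makes the maximal members of a finite subcover pairwise disjoint. The points
  \<open>x\<close> and \<open>y\<close> are too far apart for \<open>A\<close> to lie in one ball of
  radius \<open>e\<close>, so some \<open>q\<close> in \<open>A\<close> is outside the ball; a
  member \<open>W\<close> whose trace lies in that ball misses \<open>q\<close> as well, and
  \<open>q\<close> can serve as pole in \<open>squeeze_caps\<close>.\<close>

lemma caps_cover:
  fixes V :: "'a::real_inner set"
  defines "X \<equiv> {x \<in> V. norm x = 1}"
  assumes V: "subspace V" and comp: "compact X" and A: "compact A" "A \<subseteq> X"
    and \<B>: "cap_basis X A \<B>" and e: "0 < e" and xy: "x \<in> A" "y \<in> A" "2 * e \<le> dist x y"
  obtains J where "finite J" "disjoint J" "A \<subseteq> \<Union>J"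
    "\<forall>D\<in>J. openin (top_of_set X) D \<and> D \<noteq> {} \<and> (\<exists>a\<in>A. D \<subseteq> ball a e) \<and> squeezable X A D"
proof -
  have B1: "\<exists>c t. U = cap X c t" if "U \<in> \<B>" for U
    using \<B> that by (simp add: cap_basis_def)
  have B2: "U \<inter> W = {} \<or> U \<subseteq> W \<or> W \<subseteq> U" if "U \<in> \<B>" "W \<in> \<B>" for U W
    using \<B> that by (simp add: cap_basis_def)
  have "\<forall>a\<in>A. \<exists>U. U \<in> \<B> \<and> a \<in> U \<and> U \<inter> A \<subseteq> ball a e"
    using \<B> e by (simp add: cap_basis_def Bex_def)
  from bchoice[OF this] obtain U where "\<forall>a\<in>A. U a \<in> \<B> \<and> a \<in> U a \<and> U a \<inter> A \<subseteq> ball a e" ..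
  then have U: "\<And>a. a \<in> A \<Longrightarrow> U a \<in> \<B> \<and> a \<in> U a \<and> U a \<inter> A \<subseteq> ball a e" by simp
  have Uc: "\<exists>c t. U a = cap X c t" if "a \<in> A" for a using B1[of "U a"] U[OF that] by simp
  have Uo: "openin (top_of_set X) (U a)" if "a \<in> A" for a using Uc[OF that] openin_cap by (elim exE) simp
  obtain C where C: "C \<subseteq> A" "finite C" "A \<subseteq> (\<Union>a\<in>C. U a)"
  proof -
    have "\<forall>a\<in>A. \<exists>Q. open Q \<and> U a = X \<inter> Q" using Uo by (simp add: openin_open)
    from bchoice[OF this] obtain O' where "\<forall>a\<in>A. open (O' a) \<and> U a = X \<inter> O' a" ..
    then have O': "\<And>a. a \<in> A \<Longrightarrow> open (O' a) \<and> U a = X \<inter> O' a" by simp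
    have "A \<subseteq> (\<Union>a\<in>A. O' a)" using U O' by blast
    then obtain C where "C \<subseteq> A" "finite C" "A \<subseteq> (\<Union>a\<in>C. O' a)"
      using compactE_image[OF A(1), of A O'] O' by blast
    moreover from this have "A \<subseteq> (\<Union>a\<in>C. U a)" using O' A(2) by blast
    ultimately show thesis using that by blast
  qed
  define M where "M = {W \<in> U ` C. \<forall>W'\<in>U ` C. W \<subseteq> W' \<longrightarrow> W' = W}"
  have Mc: "A \<subseteq> \<Union>M"
  proof
    fix a assume "a \<in> A"
    then have "a \<in> \<Union>(U ` C)" using C by auto
    then show "a \<in> \<Union>M" using maximal_members_cover[of "U ` C" a] C(2) unfolding M_def by auto
  qed
  have Mfin: "finite M" using C by (simp add: M_def)
  have "\<forall>W\<in>M. \<exists>a. a \<in> C \<and> W = U a" by (auto simp: M_def)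
  from bchoice[OF this] obtain g where "\<forall>W\<in>M. g W \<in> C \<and> W = U (g W)" ..
  then have g: "\<And>W. W \<in> M \<Longrightarrow> g W \<in> C \<and> W = U (g W)" by blast
  have gA: "g W \<in> A" "W \<in> \<B>" "W \<inter> A \<subseteq> ball (g W) e" "g W \<in> W" if "W \<in> M" for W
  proof -
    have gW: "g W \<in> A" "W = U (g W)" using g[OF that] C(1) by auto
    show "g W \<in> A" by (rule gW)
    show "W \<in> \<B>" "W \<inter> A \<subseteq> ball (g W) e" "g W \<in> W" using U[OF gW(1)] gW(2) by simp_all
  qed
  have Mdis: "W \<inter> W' = {}" if "W \<in> M" "W' \<in> M" "W \<noteq> W'" for W W'
    using that B2[OF gA(2)[OF that(1)] gA(2)[OF that(2)]] unfolding M_def by blast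
  \<comment> \<open>\<open>W\<close> may be much larger than its trace on \<open>A\<close>; the cut
    makes the piece itself small and removes no point of \<open>A\<close>.\<close>
  define D where "D W = W \<inter> ball (g W) e" for W
  have AD: "A \<inter> D W = A \<inter> W" if "W \<in> M" for W using gA[OF that] by (auto simp: D_def)
  show thesis
  proof (rule that[of "D ` M"])
    show "finite (D ` M)" using Mfin by simp
    show "disjoint (D ` M)"
    proof (unfold disjoint_def, intro ballI impI)
      fix E E' assume "E \<in> D ` M" "E' \<in> D ` M" "E \<noteq> E'"
      then obtain W W' where "W \<in> M" "W' \<in> M" "E = D W" "E' = D W'" "W \<noteq> W'" by (auto elim!: imageE)
      then show "E \<inter> E' = {}" using Mdis[of W W'] by (auto simp: D_def)
    qed
    show "A \<subseteq> \<Union> (D ` M)"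
    proof
      fix a assume a: "a \<in> A"
      then obtain W where W: "W \<in> M" "a \<in> W" using Mc by auto
      then have "a \<in> D W" using AD[OF W(1)] a by auto
      then show "a \<in> \<Union> (D ` M)" using W(1) by auto
    qed
    show "\<forall>E\<in>D ` M. openin (top_of_set X) E \<and> E \<noteq> {} \<and> (\<exists>a\<in>A. E \<subseteq> ball a e) \<and> squeezable X A E"
    proof
      fix E assume "E \<in> D ` M"
      then obtain W where W: "W \<in> M" "E = D W" by (auto elim!: imageE)
      obtain c t where ct: "W = cap X c t" using B1[OF gA(2)[OF W(1)]] by blast
      have Wo: "openin (top_of_set X) W" unfolding ct by (rule openin_cap)
      have WS: "W \<subseteq> X" by (auto simp: ct cap_def)
      have Eo: "openin (top_of_set X) E" unfolding W(2) D_def using Wo by (simp add: openin_Int_open)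
      have gE: "g W \<in> E" using gA[OF W(1)] e by (auto simp: W(2) D_def)
      \<comment> \<open>The chordal ball of radius \<open>e\<close> about a unit vector
        \<open>c'\<close> is a cap, since \<open>(dist c' x)^2 = 2 - 2 * (c' \<bullet> x)\<close> on
        the sphere.\<close>
      define c' t' where "c' = g W" and "t' = 1 - e\<^sup>2 / 2"
      have gS: "norm c' = 1" using gA[OF W(1)] A(2) by (auto simp: c'_def X_def)
      have ball: "x \<in> ball (g W) e \<longleftrightarrow> t' < c' \<bullet> x" if "x \<in> X" for x
      proof -
        have "(dist c' x)\<^sup>2 = 2 - 2 * (c' \<bullet> x)"
          using that gS by (simp add: X_def dist_norm power2_norm_eq_inner inner_diff_left inner_diff_right norm_eq_1 inner_commute)
        moreover have "dist c' x < e \<longleftrightarrow> (dist c' x)\<^sup>2 < e\<^sup>2"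
          using e by (metis less_imp_le power_mono_iff not_le pos2 zero_le_dist)
        ultimately show ?thesis by (auto simp: c'_def t'_def)
      qed
      have E: "E = {x \<in> X. t < c \<bullet> x \<and> t' < c' \<bullet> x}"
        using ball WS by (auto simp: W(2) D_def ct cap_def)
      have "squeezable X A E"
        unfolding squeezable_def
      proof (intro ballI allI impI)
        fix p N assume p: "p \<in> E" "open (N::'a set)" "p \<in> N"
        have "\<not> A \<subseteq> ball (g W) e"
        proof
          assume "A \<subseteq> ball (g W) e"
          then have "dist (g W) x < e" "dist (g W) y < e" using xy by auto
          then show False using xy(3) dist_triangle_less_add[of x "g W" e y e] by (simp add: dist_commute)
        qed
        then obtain q where qA: "q \<in> A" "q \<notin> ball (g W) e" by blast
        then have "q \<notin> W" using gA[OF W(1)] by blast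
        have qS: "q \<in> X" using qA A by blast
        interpret pole V q using V comp qS by unfold_locales (auto simp: X_def)
        have 1: "c \<bullet> q \<le> t" "c' \<bullet> q \<le> t'"
          using \<open>q \<notin> W\<close> qS qA(2) ball[OF qS] unfolding ct cap_def mem_Collect_eq by linarith+
        have 2: "p \<in> {x \<in> V. norm x = 1}" "t < c \<bullet> p" "t' < c' \<bullet> p" using p(1) unfolding E X_def by simp_all
        \<comment> \<open>The trace is closed because it is \<open>A\<close> minus the other maximal
          members, which are open.\<close>
        have 3: "compact (A \<inter> E)"
        proof -
          have "A \<inter> E = A \<inter> W" using AD[OF W(1)] W(2) by simp
          also have "A \<inter> W = A - \<Union>(M - {W})"
          proof (rule equalityI; rule subsetI)
            fix a assume a: "a \<in> A \<inter> W"
            have "a \<notin> W'" if "W' \<in> M - {W}" for W'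
              using Mdis[of W W'] W(1) that a by (metis DiffE Int_iff empty_iff insertI1)
            then show "a \<in> A - \<Union>(M - {W})" using a by auto
          next
            fix a assume a: "a \<in> A - \<Union>(M - {W})"
            then show "a \<in> A \<inter> W" using Mc by auto
          qed
          finally have "A \<inter> E = A - \<Union>(M - {W})" .
          moreover have "openin (top_of_set X) (\<Union>(M - {W}))"
          proof (rule openin_Union)
            fix W' assume "W' \<in> M - {W}"
            then have "W' \<in> M" by simp
            from Uo[OF gA(1)[OF this]] g[OF this] show "openin (top_of_set X) W'" by metis
          qed
          then obtain Q where Q: "open Q" "\<Union>(M - {W}) = X \<inter> Q" unfolding openin_open by (elim exE conjE)
          ultimately have "A \<inter> E = A - X \<inter> Q" by simp
          also have "\<dots> = A - Q" using A(2) by auto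
          finally show ?thesis using compact_diff[OF A(1) Q(1)] by simp
        qed
        have 4: "A \<inter> E \<subseteq> {x \<in> V. norm x = 1}" using A by (auto simp: X_def)
        have 5: "t < c \<bullet> x \<and> t' < c' \<bullet> x" if "x \<in> A \<inter> E" for x using that E by simp
        show "\<exists>s r. homeomorphism X X s r \<and> (\<forall>x\<in>X - E. s x = x) \<and> s ` (A \<inter> E) \<subseteq> N"
        proof (rule squeeze_caps[OF 1 2 3 4 5 p(2,3)])
          fix s r assume sr: "homeomorphism S S s r"
            "\<And>x. x \<in> S \<Longrightarrow> \<not> (t < c \<bullet> x \<and> t' < c' \<bullet> x) \<Longrightarrow> s x = x" "s ` (A \<inter> E) \<subseteq> N"
          have "s x = x" if "x \<in> X - E" for x
            using that sr(2)[of x] unfolding E X_def by simp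
          then show ?thesis using sr(1,3) unfolding X_def by (intro exI[of _ s] exI[of _ r]) simp
        qed
      qed
      then show "openin (top_of_set X) E \<and> E \<noteq> {} \<and> (\<exists>a\<in>A. E \<subseteq> ball a e) \<and> squeezable X A E"
        using Eo gE gA[OF W(1)] by (auto simp: W(2) D_def)
    qed
  qed
qed

section \<open>Generic homeomorphisms\<close>

text \<open>Halving radii make the sequence uniformly Cauchy. The limit stays within
  \<open>d k\<close> of the \<open>k\<close>-th map, so a property shared by all maps that close to
  it passes to the limit.\<close>

lemma uniform_geometric_limit:
  fixes u :: "nat \<Rightarrow> 'a::metric_space \<Rightarrow> 'b::metric_space" and d :: "nat \<Rightarrow> real"
  assumes T: "compact T" and uS: "\<And>k x. x \<in> S \<Longrightarrow> u k x \<in> T" and cont: "\<And>k. continuous_on S (u k)"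
    and d: "\<And>k. 0 < d k" "\<And>k. d (Suc k) \<le> d k / 2"
    and u: "\<And>k x. x \<in> S \<Longrightarrow> dist (u (Suc k) x) (u k x) \<le> d k / 2"
  obtains F where "continuous_on S F" "F ` S \<subseteq> T" "\<And>k x. x \<in> S \<Longrightarrow> dist (F x) (u k x) \<le> d k"
    "d \<longlonglongrightarrow> 0"
proof -
  have dk: "d k \<le> d 0 * (1/2) ^ k" for k
  proof (induction k)
    case (Suc k)
    then show ?case using d(2)[of k] by simp
  qed simp
  have d0: "d \<longlonglongrightarrow> 0"
  proof (rule tendsto_sandwich[of "\<lambda>_. 0" _ _ "\<lambda>k. d 0 * (1/2) ^ k"])
    show "(\<lambda>k. d 0 * (1/2) ^ k) \<longlonglongrightarrow> 0"
      by (intro tendsto_mult_right_zero LIMSEQ_power_zero) simp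
  qed (use d(1) dk in \<open>auto intro!: always_eventually less_imp_le\<close>)
  \<comment> \<open>Subtracting \<open>d (k + j)\<close> makes the induction close: the next step
    costs at most \<open>d (k + j) / 2\<close>, which is at most
    \<open>d (k + j) - d (k + Suc j)\<close>.\<close>
  have tail: "dist (u (k + j) x) (u k x) \<le> d k - d (k + j)" if "x \<in> S" for k j x
  proof (induction j)
    case (Suc j)
    have "dist (u (k + Suc j) x) (u k x) \<le> dist (u (k + Suc j) x) (u (k + j) x) + dist (u (k + j) x) (u k x)"
      by (rule dist_triangle)
    also have "\<dots> \<le> d (k + j) / 2 + (d k - d (k + j))"
      using u[OF that, of "k + j"] Suc by simp
    also have "\<dots> \<le> d k - d (k + Suc j)" using d(2)[of "k + j"] by simp
    finally show ?case .
  qed simp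
  have tail': "dist (u m x) (u k x) \<le> d k" if "x \<in> S" "k \<le> m" for k m x
    using tail[OF that(1), of k "m - k"] that(2) d(1)[of m] by simp
  have "\<exists>l\<in>T. (\<lambda>k. u k x) \<longlonglongrightarrow> l" if x: "x \<in> S" for x
  proof -
    have "Cauchy (\<lambda>k. u k x)"
    proof (rule metric_CauchyI)
      fix e :: real assume "0 < e"
      then obtain N where N: "d N < e / 2"
        using order_tendstoD(2)[OF d0, of "e/2"] by (auto simp: eventually_sequentially)
      show "\<exists>M. \<forall>m\<ge>M. \<forall>n\<ge>M. dist (u m x) (u n x) < e"
      proof (intro exI allI impI)
        fix m n assume "N \<le> m" "N \<le> n"
        then have "dist (u m x) (u N x) < e/2" "dist (u n x) (u N x) < e/2"
          using tail'[OF x, of N m] tail'[OF x, of N n] N by auto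
        then show "dist (u m x) (u n x) < e" by (rule dist_triangle_half_l)
      qed
    qed
    then show ?thesis using completeE[OF compact_imp_complete[OF T], of "\<lambda>k. u k x"] uS[OF x] by metis
  qed
  then have "\<forall>x\<in>S. \<exists>l. l \<in> T \<and> (\<lambda>k. u k x) \<longlonglongrightarrow> l" by blast
  from bchoice[OF this] obtain F where F: "\<forall>x\<in>S. F x \<in> T \<and> (\<lambda>k. u k x) \<longlonglongrightarrow> F x" ..
  have close: "dist (F x) (u k x) \<le> d k" if "x \<in> S" for k x
  proof (rule LIMSEQ_le_const2)
    show "(\<lambda>m. dist (u m x) (u k x)) \<longlonglongrightarrow> dist (F x) (u k x)"
      using F that by (intro tendsto_dist tendsto_const) blast
    show "\<exists>N. \<forall>m\<ge>N. dist (u m x) (u k x) \<le> d k"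
      using tail'[OF that] by blast
  qed
  have "uniform_limit S u F sequentially"
  proof (rule uniform_limitI)
    fix e :: real assume "0 < e"
    show "\<forall>\<^sub>F n in sequentially. \<forall>x\<in>S. dist (u n x) (F x) < e"
      using order_tendstoD(2)[OF d0 \<open>0 < e\<close>]
    proof eventually_elim
      case (elim k)
      then show ?case using close[of _ k] by (metis dist_commute le_less_trans)
    qed
  qed
  then have "continuous_on S F"
    by (rule uniform_limit_theorem[rotated]) (auto simp: cont)
  moreover have "F ` S \<subseteq> T" using F by blast
  ultimately show thesis using that close d0 by blast
qed

text \<open>A Baire category argument in the group of self-homeomorphisms of \<open>S\<close> that fix \<open>q\<close>.\<close>

lemma homeomorphism_generic:
  fixes S :: "'a::metric_space set" and P :: "nat \<Rightarrow> ('a \<Rightarrow> 'a) \<Rightarrow> bool"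
  assumes S: "compact S" "q \<in> S"
    and dense: "\<And>k f g d. homeomorphism S S f g \<Longrightarrow> f q = q \<Longrightarrow> 0 < d \<Longrightarrow>
      \<exists>f' g'. homeomorphism S S f' g' \<and> f' q = q \<and> (\<forall>x\<in>S. dist (f' x) (f x) \<le> d \<and> dist (g' x) (g x) \<le> d) \<and> P k f'"
    and open_P: "\<And>k f g. homeomorphism S S f g \<Longrightarrow> f q = q \<Longrightarrow> P k f \<Longrightarrow>
      \<exists>d>0. \<forall>f'. (\<forall>x\<in>S. dist (f' x) (f x) \<le> d) \<longrightarrow> P k f'"
  obtains f g where "homeomorphism S S f g" "f q = q" "\<And>k. P k f"
proof -
  \<comment> \<open>A state is a map, its inverse and a radius within which \<open>P k\<close>
    persists. \<open>R\<close> bounds the next move and the next radius by half the present one, so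
    all later maps stay in the ball chosen at stage \<open>k\<close>.\<close>
  define Q where "Q k z \<longleftrightarrow> (case z of (f, g, d) \<Rightarrow> homeomorphism S S f g \<and> f q = q \<and> 0 < d \<and>
    (\<forall>f'. (\<forall>x\<in>S. dist (f' x) (f x) \<le> d) \<longrightarrow> P k f'))" for k and z :: "('a \<Rightarrow> 'a) \<times> ('a \<Rightarrow> 'a) \<times> real"
  define R where "R z z' \<longleftrightarrow> (case z of (f, g, d) \<Rightarrow> case z' of (f', g', d') \<Rightarrow> d' \<le> d / 2 \<and>
    (\<forall>x\<in>S. dist (f' x) (f x) \<le> d / 2 \<and> dist (g' x) (g x) \<le> d / 2))"
    for z z' :: "('a \<Rightarrow> 'a) \<times> ('a \<Rightarrow> 'a) \<times> real"
  have step: "\<exists>z'. Q k z' \<and> R (f, g, d) z'" if fg: "homeomorphism S S f g" "f q = q" "0 < d" for k f g d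
  proof -
    obtain f' g' where f': "homeomorphism S S f' g'" "f' q = q" "P k f'"
      "\<forall>x\<in>S. dist (f' x) (f x) \<le> d / 2 \<and> dist (g' x) (g x) \<le> d / 2"
      using dense[OF fg(1,2), of "d / 2" k] fg(3) by auto
    obtain d' where d': "0 < d'" "\<And>h. \<forall>x\<in>S. dist (h x) (f' x) \<le> d' \<Longrightarrow> P k h"
      using open_P[OF f'(1,2,3)] by blast
    have "Q k (f', g', min d' (d / 2))" using f' d' fg(3) by (simp add: Q_def)
    moreover have "R (f, g, d) (f', g', min d' (d / 2))" using f' by (simp add: R_def)
    ultimately show ?thesis by blast
  qed
  have "\<exists>z. \<forall>k. Q k (z k) \<and> R (z k) (z (Suc k))"
  proof (rule dependent_nat_choice)
    show "\<exists>z. Q 0 z"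
      using step[of "\<lambda>x. x" "\<lambda>x. x" 1 0] homeomorphism_ident by auto
    show "\<exists>z'. Q (Suc k) z' \<and> R z z'" if "Q k z" for z k
    proof -
      obtain f g d where "z = (f, g, d)" by (cases z)
      then show ?thesis using step[of f g d "Suc k"] that by (simp add: Q_def)
    qed
  qed
  then obtain z where z: "\<And>k. Q k (z k)" "\<And>k. R (z k) (z (Suc k))" by blast
  define u v d where "u k = fst (z k)" and "v k = fst (snd (z k))" and "d k = snd (snd (z k))" for k
  have zk: "z k = (u k, v k, d k)" for k by (simp add: u_def v_def d_def)
  have hom: "homeomorphism S S (u k) (v k)" "u k q = q" "0 < d k"
     and Pk: "\<And>f'. \<forall>x\<in>S. dist (f' x) (u k x) \<le> d k \<Longrightarrow> P k f'" for k
    using z(1)[of k] unfolding zk Q_def by auto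
  have st: "d (Suc k) \<le> d k / 2" "\<And>x. x \<in> S \<Longrightarrow> dist (u (Suc k) x) (u k x) \<le> d k / 2"
     "\<And>x. x \<in> S \<Longrightarrow> dist (v (Suc k) x) (v k x) \<le> d k / 2" for k
    using z(2)[of k] unfolding zk R_def by auto
  have huv: "continuous_on S (u k)" "continuous_on S (v k)" "\<And>x. x \<in> S \<Longrightarrow> u k x \<in> S" "\<And>x. x \<in> S \<Longrightarrow> v k x \<in> S"
    "\<And>x. x \<in> S \<Longrightarrow> v k (u k x) = x" "\<And>x. x \<in> S \<Longrightarrow> u k (v k x) = x" for k
    using hom(1)[of k] by (auto simp: homeomorphism_def)
  obtain F where F: "continuous_on S F" "F ` S \<subseteq> S" "\<And>k x. x \<in> S \<Longrightarrow> dist (F x) (u k x) \<le> d k" and d0: "d \<longlonglongrightarrow> 0"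
    using uniform_geometric_limit[where u = u and S = S, OF S(1) huv(3) huv(1) hom(3) st(1,2)] by metis
  obtain G where G: "continuous_on S G" "G ` S \<subseteq> S" "\<And>k x. x \<in> S \<Longrightarrow> dist (G x) (v k x) \<le> d k"
    using uniform_geometric_limit[where u = v and S = S, OF S(1) huv(4) huv(2) hom(3) st(1,3)] by metis
  \<comment> \<open>\<open>F (v k y)\<close> is within \<open>d k\<close> of
    \<open>u k (v k y) = y\<close>, while \<open>v k y\<close> tends to \<open>G y\<close>. Control
    of the inverses is thus what makes the limit bijective; the claim is used twice, with the roles
    exchanged.\<close>
  have inv: "F (G y) = y" if "y \<in> S" and F: "continuous_on S F" "\<And>k x. x \<in> S \<Longrightarrow> dist (F x) (u k x) \<le> d k"
     and G: "G ` S \<subseteq> S" "\<And>k x. x \<in> S \<Longrightarrow> dist (G x) (v k x) \<le> d k"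
     and uv: "\<And>k x. x \<in> S \<Longrightarrow> u k (v k x) = x" "\<And>k x. x \<in> S \<Longrightarrow> v k x \<in> S"
     for F G u v y
  proof -
    have "(\<lambda>k. v k y) \<longlonglongrightarrow> G y"
      using G(2)[OF \<open>y \<in> S\<close>] by (intro metric_tendsto_imp_tendsto[OF d0]) (auto simp: dist_commute intro!: always_eventually order_trans[OF _ abs_ge_self])
    then have "(\<lambda>k. F (v k y)) \<longlonglongrightarrow> F (G y)"
      using \<open>y \<in> S\<close> G(1) uv(2) by (intro continuous_on_tendsto_compose[OF F(1)]) auto
    moreover have "(\<lambda>k. F (v k y)) \<longlonglongrightarrow> y"
    proof (rule metric_tendsto_imp_tendsto[OF d0], rule always_eventually, rule allI)
      fix k
      show "dist (F (v k y)) y \<le> dist (d k) 0"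
        using F(2)[OF uv(2)[OF \<open>y \<in> S\<close>], of k k] uv(1)[OF \<open>y \<in> S\<close>, of k] by simp
    qed
    ultimately show ?thesis by (rule LIMSEQ_unique)
  qed
  have FG: "F (G y) = y" if "y \<in> S" for y
    by (rule inv[where u = u and v = v, OF that F(1,3) G(2,3) huv(6,4)])
  have GF: "G (F y) = y" if "y \<in> S" for y
    by (rule inv[where u = v and v = u, OF that G(1,3) F(2,3) huv(5,3)])
  have "homeomorphism S S F G"
    using F(1,2) G(1,2) FG GF by (intro homeomorphismI) auto
  moreover have "F q = q"
  proof -
    have "dist (F q) q \<le> d k" for k using F(3)[OF S(2), of k] hom(2) by simp
    then have "dist (F q) q \<le> 0" by (intro LIMSEQ_le_const[OF d0]) auto
    then show ?thesis by simp
  qed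
  moreover have "P k F" for k using Pk F(3) by blast
  ultimately show thesis using that by blast
qed

section \<open>Separation by a coordinate\<close>

text \<open>Cross-multiplied form of \<open>stereo q (f x) \<bullet> e \<noteq> stereo q (f y) \<bullet> e\<close> for \<open>q \<bullet> e = 0\<close>, which avoids the
  division by zero at \<open>q\<close> and is visibly an open condition.\<close>

definition separating :: "'a::real_inner \<Rightarrow> 'a \<Rightarrow> 'a set \<Rightarrow> real \<Rightarrow> ('a \<Rightarrow> 'a) \<Rightarrow> bool" where
  "separating q e A d f \<longleftrightarrow>
    (\<forall>x\<in>A. \<forall>y\<in>A. d \<le> dist x y \<longrightarrow> (f x \<bullet> e) * (1 - f y \<bullet> q) \<noteq> (f y \<bullet> e) * (1 - f x \<bullet> q))"

text \<open>The pairs at distance at least \<open>d\<close> form a compact set, so their images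
  under \<open>f\<close> in both coordinates have a positive margin inside the open set of separated
  pairs.\<close>

lemma open_separating:
  fixes A :: "'a::real_inner set"
  assumes A: "compact A" and f: "continuous_on A f" and sep: "separating q e A d f"
  shows "\<exists>\<epsilon>>0. \<forall>f'. (\<forall>x\<in>A. dist (f' x) (f x) \<le> \<epsilon>) \<longrightarrow> separating q e A d f'"
proof -
  define P where "P = {z \<in> A \<times> A. d \<le> dist (fst z) (snd z)}"
  define W where "W = {z::'a \<times> 'a. (fst z \<bullet> e) * (1 - snd z \<bullet> q) \<noteq> (snd z \<bullet> e) * (1 - fst z \<bullet> q)}"
  have "P = (A \<times> A) \<inter> {z. d \<le> dist (fst z) (snd z)}" by (auto simp: P_def)
  moreover have "closed {z::'a \<times> 'a. d \<le> dist (fst z) (snd z)}"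
    by (intro closed_Collect_le continuous_intros)
  ultimately have "compact P" using A by (simp add: compact_Times compact_Int_closed)
  have "continuous_on P (\<lambda>z. (f (fst z), f (snd z)))"
    by (intro continuous_on_Pair continuous_on_compose2[OF f] continuous_intros) (auto simp: P_def)
  then have Q: "compact ((\<lambda>z. (f (fst z), f (snd z))) ` P)" (is "compact ?Q")
    using \<open>compact P\<close> compact_continuous_image by blast
  have W: "open W" unfolding W_def by (intro open_Collect_neq continuous_intros)
  have "?Q \<subseteq> W" using sep by (auto simp: P_def W_def separating_def)
  then obtain r where r: "0 < r" "(\<Union>z\<in>?Q. ball z r) \<subseteq> W"
    using compact_subset_open_imp_ball_epsilon_subset[OF Q W] by metis
  show ?thesis
  \<comment> \<open>Errors of \<open>r / 3\<close> in the two coordinates add up to less than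
    \<open>r\<close>.\<close>
  proof (intro exI[of _ "r / 3"] conjI allI impI)
    show "0 < r / 3" using r by simp
    fix f' assume f': "\<forall>x\<in>A. dist (f' x) (f x) \<le> r / 3"
    show "separating q e A d f'"
      unfolding separating_def
    proof (intro ballI impI)
      fix x y assume xy: "x \<in> A" "y \<in> A" "d \<le> dist x y"
      have "dist (f x, f y) (f' x, f' y) \<le> dist (f x) (f' x) + dist (f y) (f' y)"
        unfolding dist_Pair_Pair by (intro sqrt_sum_squares_le_sum) auto
      also have "\<dots> \<le> r / 3 + r / 3" using f' xy(1,2) by (intro add_mono) (simp_all add: dist_commute)
      also have "\<dots> < r" using r(1) by simp
      finally have "(f' x, f' y) \<in> ball (f x, f y) r" by simp
      moreover have "(f x, f y) \<in> ?Q" using xy by (auto simp: P_def image_iff)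
      ultimately have "(f' x, f' y) \<in> W" using r(2) by blast
      then show "(f' x \<bullet> e) * (1 - f' y \<bullet> q) \<noteq> (f' y \<bullet> e) * (1 - f' x \<bullet> q)" by (simp add: W_def)
    qed
  qed
qed

lemma finite_separation:
  assumes "finite J" "inj_on t J"
  shows "\<exists>k>0. \<forall>i\<in>J. \<forall>j\<in>J. i \<noteq> j \<longrightarrow> 2 * k \<le> \<bar>t i - t j :: real\<bar>"
proof -
  define P where "P = Set.filter (\<lambda>(i, j). i \<noteq> j) (J \<times> J)"
  \<comment> \<open>The inserted 1 serves index sets with at most one element, which have no pairs.
    Taking half of \<open>m\<close> makes the open intervals of that radius about the
    \<open>t i\<close> pairwise disjoint.\<close>
  define m where "m = Min (insert 1 ((\<lambda>(i, j). \<bar>t i - t j\<bar>) ` P))"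
  have fin: "finite P" using assms(1) by (simp add: P_def)
  have "0 < m"
    unfolding m_def using fin assms(2) by (subst Min_gr_iff) (auto simp: P_def inj_on_def)
  moreover have "m \<le> \<bar>t i - t j\<bar>" if "i \<in> J" "j \<in> J" "i \<noteq> j" for i j
  proof -
    have "(i, j) \<in> P" using that by (simp add: P_def)
    then show ?thesis unfolding m_def using fin by (intro Min_le) force+
  qed
  ultimately show ?thesis by (intro exI[of _ "m / 2"]) auto
qed

context pole begin

text \<open>Moving along \<open>e\<close> in the chart from a point of \<open>G\<close> stays in
  \<open>G\<close> for a short time and changes the coordinate at unit speed, so a whole interval of
  values occurs.\<close>

lemma infinite_projection:
  assumes G: "openin (top_of_set S) G" "x \<in> G" "x \<noteq> q" and e: "e \<in> H" "norm e = 1"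
  shows "infinite ((\<lambda>x. stereo q x \<bullet> e) ` (G - {q}))"
proof -
  obtain Q where Q: "open Q" "G = S \<inter> Q" using G(1) unfolding openin_open by (elim exE conjE)
  have x: "x \<in> S" "x \<in> Q" using G(2) Q(2) by auto
  define v where "v = stereo q x"
  have v: "v \<in> H" "unstereo q v = x" using stereo_H[OF x(1)] unstereo_stereo[OF x(1) G(3)] by (auto simp: v_def)
  have vt: "v + t *\<^sub>R e \<in> H" for t using subH v(1) e(1) by (intro subspace_add subspace_scale) auto
  define \<gamma> where "\<gamma> t = unstereo q (v + t *\<^sub>R e)" for t
  have "continuous_on UNIV (unstereo q \<circ> (\<lambda>t. v + t *\<^sub>R e))"
    by (intro continuous_on_compose continuous_unstereo continuous_intros)
  then have "open (\<gamma> -` Q)" using open_vimage[OF Q(1)] by (simp add: \<gamma>_def[abs_def] o_def)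
  moreover have "0 \<in> \<gamma> -` Q" using v x by (simp add: \<gamma>_def)
  ultimately obtain r where r: "0 < r" "ball 0 r \<subseteq> \<gamma> -` Q" by (meson openE)
  have e1: "e \<bullet> e = 1" using e by (simp add: norm_eq_1)
  have "(\<lambda>t. v \<bullet> e + t) ` ball 0 r \<subseteq> (\<lambda>x. stereo q x \<bullet> e) ` (G - {q})"
  proof
    fix z assume "z \<in> (\<lambda>t. v \<bullet> e + t) ` ball 0 r"
    then obtain t where t: "t \<in> ball 0 r" "z = v \<bullet> e + t" by blast
    have "\<gamma> t \<in> G - {q}" using r(2) t(1) unstereo_S[OF vt] unstereo_neq[OF vt] by (auto simp: Q(2) \<gamma>_def)
    moreover have "stereo q (\<gamma> t) \<bullet> e = z" by (simp add: \<gamma>_def stereo_unstereo[OF vt] t(2) inner_add_left e1)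
    ultimately show "z \<in> (\<lambda>x. stereo q x \<bullet> e) ` (G - {q})" by blast
  qed
  moreover have "infinite ((\<lambda>t. v \<bullet> e + t) ` ball 0 r)"
  proof -
    have "infinite (ball (0::real) r)" using r(1) by (simp add: ball_eq_greaterThanLessThan)
    then show ?thesis by (subst finite_image_iff) (auto simp: inj_on_def)
  qed
  ultimately show ?thesis using infinite_super by metis
qed

lemma stereo_inner_eq_iff:
  assumes "x \<in> S" "y \<in> S" "x \<noteq> q" "y \<noteq> q" "e \<in> H"
  shows "stereo q x \<bullet> e = stereo q y \<bullet> e \<longleftrightarrow> (x \<bullet> e) * (1 - y \<bullet> q) = (y \<bullet> e) * (1 - x \<bullet> q)"
proof -
  have "q \<bullet> e = 0" using assms(5) by (simp add: inner_commute)
  then show ?thesis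
    using inner_q_less[OF assms(1,3)] inner_q_less[OF assms(2,4)] by (simp add: inner_stereo frac_eq_eq)
qed

text \<open>The perturbed map is \<open>f \<circ> F\<close>, where \<open>F\<close> squeezes the
  part of \<open>A\<close> in each piece \<open>D\<close> of a fine cover to a place where the
  coordinate of \<open>f\<close> is within \<open>k\<close> of a value \<open>t D\<close>. The
  values of different pieces are at least \<open>2 * k\<close> apart, and points at distance at
  least \<open>\<epsilon>\<close> lie in different pieces.\<close>

lemma dense_separating:
  assumes A: "compact A" "A \<subseteq> S" "q \<notin> A" and \<B>: "cap_basis S A \<B>" and e: "e \<in> H" "norm e = 1"
    and ab: "a \<in> A" "b \<in> A" "a \<noteq> b" and fg: "homeomorphism S S f g" "f q = q" and d: "0 < d" "0 < \<epsilon>"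
  shows "\<exists>f' g'. homeomorphism S S f' g' \<and> f' q = q \<and> (\<forall>x\<in>S. dist (f' x) (f x) \<le> d \<and> dist (g' x) (g x) \<le> d) \<and>
    separating q e A \<epsilon> f'"
proof -
  have fgS: "\<And>x. x \<in> S \<Longrightarrow> f x \<in> S" "\<And>x. x \<in> S \<Longrightarrow> g x \<in> S" "\<And>x. x \<in> S \<Longrightarrow> g (f x) = x" "\<And>x. x \<in> S \<Longrightarrow> f (g x) = x" "continuous_on S f"
    using fg(1) unfolding homeomorphism_def by auto
  have qS: "q \<in> S" using q by simp
  have fq: "f x \<noteq> q" if "x \<in> S" "x \<noteq> q" for x using that fgS(3) fg(2) qS by metis
  have "uniformly_continuous_on S f" using fgS(5) comp compact_uniformly_continuous by blast
  then obtain \<eta> where \<eta>: "0 < \<eta>" "\<And>x x'. x \<in> S \<Longrightarrow> x' \<in> S \<Longrightarrow> dist x' x < \<eta> \<Longrightarrow> dist (f x') (f x) < d"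
    unfolding uniformly_continuous_on_def using d(1) by meson
  have "open (- A)" using A(1) compact_imp_closed by blast
  then obtain \<rho> where \<rho>: "0 < \<rho>" "ball q \<rho> \<subseteq> - A" using A(3) by (meson ComplI openE)
  \<comment> \<open>\<open>\<eta>\<close> keeps \<open>f \<circ> F\<close> close to
    \<open>f\<close>, \<open>d\<close> keeps \<open>G \<circ> g\<close> close to \<open>g\<close>,
    \<open>\<epsilon>\<close> puts distant points into different pieces, \<open>dist a b\<close>
    meets the diameter bound of \<open>caps_cover\<close>, and \<open>\<rho>\<close> keeps
    \<open>q\<close> outside all pieces.\<close>
  define \<epsilon>0 where "\<epsilon>0 = Min {\<eta> / 2, d / 2, \<epsilon> / 2, dist a b / 2, \<rho>}"
  have e0: "0 < \<epsilon>0" "2 * \<epsilon>0 \<le> \<eta>" "2 * \<epsilon>0 \<le> d" "2 * \<epsilon>0 \<le> \<epsilon>" "2 * \<epsilon>0 \<le> dist a b" "\<epsilon>0 \<le> \<rho>"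
    using \<eta>(1) d \<rho>(1) ab(3) by (auto simp: \<epsilon>0_def min_def)
  obtain J where J: "finite J" "disjoint J" "A \<subseteq> \<Union>J"
    "\<forall>D\<in>J. openin (top_of_set S) D \<and> D \<noteq> {} \<and> (\<exists>a\<in>A. D \<subseteq> ball a \<epsilon>0) \<and> squeezable S A D"
    by (rule caps_cover[OF subV comp A(1,2) \<B> e0(1) ab(1,2) e0(5)])
  have Jball: "\<exists>c\<in>A. D \<subseteq> ball c \<epsilon>0" and Jne: "D \<noteq> {}" and Jo: "openin (top_of_set S) D"
    and Jsq: "squeezable S A D" if "D \<in> J" for D
    using bspec[OF J(4) that] by simp_all
  have JS: "D \<subseteq> S" if "D \<in> J" for D using openin_imp_subset[OF Jo[OF that]] .
  have Jd: "dist x y < 2 * \<epsilon>0" if "D \<in> J" "x \<in> D" "y \<in> D" for D x y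
  proof -
    from Jball[OF that(1)] obtain c where "D \<subseteq> ball c \<epsilon>0" ..
    then have "dist c x < \<epsilon>0" "dist c y < \<epsilon>0" using that by auto
    then show ?thesis using dist_triangle_less_add[of x c \<epsilon>0 y \<epsilon>0] by (simp add: dist_commute)
  qed
  have Jq: "q \<notin> D" if "D \<in> J" for D
  proof
    assume "q \<in> D"
    from Jball[OF that] obtain c where c: "c \<in> A" "D \<subseteq> ball c \<epsilon>0" ..
    then have "c \<in> ball q \<rho>" using e0(6) \<open>q \<in> D\<close> by (auto simp: dist_commute)
    then show False using \<rho>(2) c(1) by auto
  qed
  define pr where "pr x = stereo q (f x) \<bullet> e" for x
  have "infinite (pr ` D)" if "D \<in> J" for D
  proof -
    from Jne[OF that] obtain x where x: "x \<in> D" by auto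
    have "openin (top_of_set S) (f ` D)" using homeomorphism_imp_open_map[OF fg(1) Jo[OF that]] .
    moreover have "f x \<in> f ` D" using x by simp
    moreover have "f x \<noteq> q" using fq[of x] subsetD[OF JS[OF that] x] Jq[OF that] x by metis
    ultimately have "infinite ((\<lambda>x. stereo q x \<bullet> e) ` (f ` D - {q}))" by (intro infinite_projection e)
    moreover have "(\<lambda>x. stereo q x \<bullet> e) ` (f ` D - {q}) \<subseteq> pr ` D" by (auto simp: pr_def)
    ultimately show ?thesis using infinite_super by metis
  qed
  then obtain t where t: "inj_on t J" "\<And>D. D \<in> J \<Longrightarrow> t D \<in> pr ` D"
    using inj_choice_infinite[OF J(1), of "\<lambda>D. pr ` D"] by auto
  obtain k where k: "0 < k" "\<And>D D'. D \<in> J \<Longrightarrow> D' \<in> J \<Longrightarrow> D \<noteq> D' \<Longrightarrow> 2 * k \<le> \<bar>t D - t D'\<bar>"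
    using finite_separation[OF J(1) t(1)] by blast
  have contpr: "continuous_on (S - {q}) pr"
  proof -
    have "f ` (S - {q}) \<subseteq> S - {q}" using fgS(1) fq by auto
    moreover have "continuous_on (S - {q}) f" by (rule continuous_on_subset[OF fgS(5)]) auto
    ultimately have "continuous_on (S - {q}) (stereo q \<circ> f)"
      by (intro continuous_on_compose continuous_on_subset[OF continuous_stereo])
    then show ?thesis unfolding pr_def o_def by (intro continuous_intros)
  qed
  have "\<exists>sr. homeomorphism S S (fst sr) (snd sr) \<and> (\<forall>x\<in>S - D. fst sr x = x) \<and> (\<forall>x\<in>A \<inter> D. \<bar>pr (fst sr x) - t D\<bar> < k)"
    if D: "D \<in> J" for D
  proof -
    obtain p where p: "p \<in> D" "t D = pr p" using t(2)[OF D] by auto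
    have "openin (top_of_set (S - {q})) ((S - {q}) \<inter> pr -` ball (t D) k)"
      using contpr by (rule continuous_openin_preimage_gen) simp
    then obtain Q where Q: "open Q" "(S - {q}) \<inter> pr -` ball (t D) k = (S - {q}) \<inter> Q"
      unfolding openin_open by (elim exE conjE)
    have pS: "p \<in> S - {q}" using p(1) JS[OF D] Jq[OF D] by auto
    have "p \<in> (S - {q}) \<inter> pr -` ball (t D) k" using pS p(2) k(1) by simp
    \<comment> \<open>\<open>Q\<close> describes closeness to \<open>t D\<close> only away from
      \<open>q\<close>, so the target neighbourhood must exclude \<open>q\<close>.\<close>
    then have "p \<in> Q - {q}" unfolding Q(2) by simp
    moreover have "open (Q - {q})" using Q(1) by (simp add: open_delete)
    ultimately obtain s r where sr: "homeomorphism S S s r" "\<forall>x\<in>S - D. s x = x" "s ` (A \<inter> D) \<subseteq> Q - {q}"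
      using Jsq[OF D] p(1) unfolding squeezable_def by meson
    have "\<bar>pr (s x) - t D\<bar> < k" if x: "x \<in> A \<inter> D" for x
    proof -
      have "s x \<in> S" using x A(2) sr(1) by (auto simp: homeomorphism_def)
      moreover have "s x \<in> Q - {q}" using x sr(3) by auto
      ultimately have "s x \<in> (S - {q}) \<inter> Q" by simp
      then have "s x \<in> pr -` ball (t D) k" unfolding Q(2)[symmetric] by simp
      then show ?thesis by (simp add: dist_real_def abs_minus_commute)
    qed
    then show ?thesis using sr by (intro exI[of _ "(s, r)"]) auto
  qed
  then have "\<forall>D\<in>J. \<exists>sr. homeomorphism S S (fst sr) (snd sr) \<and> (\<forall>x\<in>S - D. fst sr x = x) \<and> (\<forall>x\<in>A \<inter> D. \<bar>pr (fst sr x) - t D\<bar> < k)"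
    by simp
  from bchoice[OF this] obtain sr where sr: "\<forall>D\<in>J. homeomorphism S S (fst (sr D)) (snd (sr D)) \<and>
     (\<forall>x\<in>S - D. fst (sr D) x = x) \<and> (\<forall>x\<in>A \<inter> D. \<bar>pr (fst (sr D) x) - t D\<bar> < k)" ..
  have "\<exists>F G. homeomorphism S S F G \<and> (\<forall>D\<in>J. \<forall>x\<in>D. F x = fst (sr D) x \<and> F x \<in> D \<and> G x \<in> D) \<and>
    (\<forall>x\<in>S - \<Union>J. F x = x \<and> G x = x)"
    using sr by (intro glue_homeomorphisms[OF J(1,2) JS, of "\<lambda>D. fst (sr D)" "\<lambda>D. snd (sr D)"]) auto
  then obtain F G where FG: "homeomorphism S S F G" "\<forall>D\<in>J. \<forall>x\<in>D. F x = fst (sr D) x \<and> F x \<in> D \<and> G x \<in> D"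
    "\<forall>x\<in>S - \<Union>J. F x = x \<and> G x = x" by (elim exE conjE)
  have FGS: "\<And>x. x \<in> S \<Longrightarrow> F x \<in> S" "\<And>x. x \<in> S \<Longrightarrow> G x \<in> S" "\<And>x. x \<in> S \<Longrightarrow> G (F x) = x"
    using FG(1) by (auto simp: homeomorphism_def)
  have close: "dist (F x) x < 2 * \<epsilon>0 \<and> dist (G x) x < 2 * \<epsilon>0" if "x \<in> S" for x
  proof (cases "x \<in> \<Union>J")
    case True
    then obtain D where D: "D \<in> J" "x \<in> D" by auto
    have FGD: "F x \<in> D" "G x \<in> D" using bspec[OF bspec[OF FG(2) D(1)] D(2)] by blast+
    show ?thesis using Jd[OF D(1) FGD(1) D(2)] Jd[OF D(1) FGD(2) D(2)] by (rule conjI)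
  next
    case False
    then show ?thesis using FG(3) that e0(1) by auto
  qed
  have qJ: "q \<in> S - \<Union>J" using qS Jq by auto
  have Fq: "F x \<noteq> q" if "x \<in> S" "x \<noteq> q" for x
    using that FGS(3) FG(3) qJ by metis
  show ?thesis
  proof (intro exI conjI ballI)
    show "homeomorphism S S (f \<circ> F) (G \<circ> g)" by (rule homeomorphism_compose[OF FG(1) fg(1)])
    show "(f \<circ> F) q = q" using FG(3) qJ fg(2) by simp
    show "dist ((f \<circ> F) x) (f x) \<le> d" if "x \<in> S" for x
      using \<eta>(2)[OF that FGS(1)[OF that]] close[OF that] e0(2) by simp
    show "dist ((G \<circ> g) x) (g x) \<le> d" if "x \<in> S" for x
      using close[OF fgS(2)[OF that]] e0(3) by simp
    show "separating q e A \<epsilon> (f \<circ> F)"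
      unfolding separating_def
    proof (intro ballI impI)
      fix x y assume xy: "x \<in> A" "y \<in> A" "\<epsilon> \<le> dist x y"
      from subsetD[OF J(3) xy(1)] obtain D where Dx: "D \<in> J" "x \<in> D" by (elim UnionE)
      from subsetD[OF J(3) xy(2)] obtain D' where Dy: "D' \<in> J" "y \<in> D'" by (elim UnionE)
      note D = Dx Dy
      have "D \<noteq> D'" using Jd[OF D(1,2), of y] D(4) xy(3) e0(4) by auto
      have F: "F x = fst (sr D) x" "F y = fst (sr D') y" using bspec[OF bspec[OF FG(2) D(1)] D(2)] bspec[OF bspec[OF FG(2) D(3)] D(4)] by blast+
      have "\<bar>pr (F x) - t D\<bar> < k" "\<bar>pr (F y) - t D'\<bar> < k" unfolding F using bspec[OF sr D(1)] bspec[OF sr D(3)] D xy by blast+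
      then have "pr (F x) \<noteq> pr (F y)" using k(2)[OF D(1,3) \<open>D \<noteq> D'\<close>] by auto
      moreover have "x \<in> S" "y \<in> S" "x \<noteq> q" "y \<noteq> q" using xy A by auto
      moreover from this have "f (F x) \<in> S" "f (F y) \<in> S" "f (F x) \<noteq> q" "f (F y) \<noteq> q"
        using fgS(1) FGS(1) fq Fq by simp_all
      ultimately show "((f \<circ> F) x \<bullet> e) * (1 - (f \<circ> F) y \<bullet> q) \<noteq> ((f \<circ> F) y \<bullet> e) * (1 - (f \<circ> F) x \<bullet> q)"
        using stereo_inner_eq_iff[of "f (F x)" "f (F y)" e] e(1) by (simp add: pr_def)
    qed
  qed
qed

end

section \<open>Flattening and Klee's trick\<close>

text \<open>The bound makes shears proper. It comes from extending into the convex set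
  \<open>cball 0 B \<inter> L\<close> rather than into all of \<open>L\<close>.\<close>

lemma Dugundji_bounded:
  fixes F :: "real \<Rightarrow> 'a::real_inner"
  assumes "compact K" "continuous_on K F" "subspace L" "F ` K \<subseteq> L"
  obtains G B where "continuous_on UNIV G" "\<And>t. G t \<in> L" "\<And>t. norm (G t) \<le> B" "\<And>t. t \<in> K \<Longrightarrow> G t = F t"
proof -
  have "bounded (F ` K)" using assms(1,2) compact_continuous_image compact_imp_bounded by blast
  then obtain B where B: "0 < B" "\<And>t. t \<in> K \<Longrightarrow> norm (F t) \<le> B" by (auto simp: bounded_pos)
  have "convex (cball 0 B \<inter> L)" using assms(3) by (intro convex_Int subspace_imp_convex convex_cball)
  moreover have "cball 0 B \<inter> L \<noteq> {}" using B(1) subspace_0[OF assms(3)] by (metis IntI centre_in_cball empty_iff less_imp_le)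
  moreover have "closedin (top_of_set UNIV) K" using assms(1) compact_imp_closed by auto
  moreover have "F ` K \<subseteq> cball 0 B \<inter> L" using B(2) assms(4) by auto
  ultimately obtain G where "continuous_on UNIV G" "G ` UNIV \<subseteq> cball 0 B \<inter> L" "\<And>t. t \<in> K \<Longrightarrow> G t = F t"
    using Dugundji[of "cball 0 B \<inter> L" UNIV K F] assms(2) by metis
  then show thesis using that[of G B] by (auto simp: image_subset_iff)
qed

definition reflect :: "'a::real_inner \<Rightarrow> 'a \<Rightarrow> 'a" where
  "reflect w x = x - (2 * (x \<bullet> w)) *\<^sub>R w"

context pole begin

text \<open>Separation at all scales \<open>1 / real (Suc k)\<close> together is injectivity, and
  each single scale is an open and dense condition.\<close>

lemma generic_injective:
  assumes A: "compact A" "A \<subseteq> S" "q \<notin> A" and \<B>: "cap_basis S A \<B>" and e: "e \<in> H" "norm e = 1"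
  obtains f g where "homeomorphism S S f g" "f q = q" "inj_on (\<lambda>x. stereo q (f x) \<bullet> e) A"
proof (cases "\<exists>a\<in>A. \<exists>b\<in>A. a \<noteq> b")
  \<comment> \<open>With at most one point there is no pair to set the mesh of a cover, and the
    identity works.\<close>
  case False
  then show thesis using that[of "\<lambda>x. x" "\<lambda>x. x"] homeomorphism_ident by (auto simp: inj_on_def)
next
  case True
  then obtain a b where ab: "a \<in> A" "b \<in> A" "a \<noteq> b" by blast
  have qS: "q \<in> S" using q by simp
  have dense: "\<exists>f' g'. homeomorphism S S f' g' \<and> f' q = q \<and>
    (\<forall>x\<in>S. dist (f' x) (f x) \<le> d \<and> dist (g' x) (g x) \<le> d) \<and> separating q e A (1 / real (Suc k)) f'"
    if "homeomorphism S S f g" "f q = q" "0 < d" for k f g d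
    by (rule dense_separating[OF A \<B> e ab that]) simp
  have op: "\<exists>d>0. \<forall>f'. (\<forall>x\<in>S. dist (f' x) (f x) \<le> d) \<longrightarrow> separating q e A (1 / real (Suc k)) f'"
    if hom: "homeomorphism S S f g" and "f q = q" and sep: "separating q e A (1 / real (Suc k)) f" for k f g
  proof -
    have "continuous_on A f" using hom A(2) continuous_on_subset by (auto simp: homeomorphism_def)
    then obtain d where d: "0 < d" "\<forall>f'. (\<forall>x\<in>A. dist (f' x) (f x) \<le> d) \<longrightarrow> separating q e A (1 / real (Suc k)) f'"
      using open_separating[OF A(1) _ sep] by blast
    have "separating q e A (1 / real (Suc k)) f'" if "\<forall>x\<in>S. dist (f' x) (f x) \<le> d" for f'
      using d(2) that A(2) by (meson subsetD)
    then show ?thesis using d(1) by blast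
  qed
  obtain f g where fg: "homeomorphism S S f g" "f q = q" "\<And>k. separating q e A (1 / real (Suc k)) f"
  proof (rule homeomorphism_generic[OF comp qS, of "\<lambda>k. separating q e A (1 / real (Suc k))"])
    fix k f g d assume "homeomorphism S S f g" "f q = q" "0 < (d::real)"
    then show "\<exists>f' g'. homeomorphism S S f' g' \<and> f' q = q \<and>
      (\<forall>x\<in>S. dist (f' x) (f x) \<le> d \<and> dist (g' x) (g x) \<le> d) \<and> separating q e A (1 / real (Suc k)) f'"
      by (rule dense)
  next
    fix k f g assume "homeomorphism S S f g" "f q = q" "separating q e A (1 / real (Suc k)) f"
    then show "\<exists>d>0. \<forall>f'. (\<forall>x\<in>S. dist (f' x) (f x) \<le> d) \<longrightarrow> separating q e A (1 / real (Suc k)) f'"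
      by (rule op)
  qed (rule that)
  have fS: "f x \<in> S" "f x \<noteq> q" if "x \<in> A" for x
  proof -
    have x: "x \<in> S" "x \<noteq> q" using that A by auto
    show "f x \<in> S" using fg(1) x by (auto simp: homeomorphism_def)
    show "f x \<noteq> q" using homeomorphism_apply1[OF fg(1) x(1)] homeomorphism_apply1[OF fg(1) qS] fg(2) x(2) by metis
  qed
  have "inj_on (\<lambda>x. stereo q (f x) \<bullet> e) A"
  proof (rule inj_onI, rule ccontr)
    fix x y assume xy: "x \<in> A" "y \<in> A" "stereo q (f x) \<bullet> e = stereo q (f y) \<bullet> e" "x \<noteq> y"
    then obtain k where "1 / real (Suc k) < dist x y" using nat_approx_posE[of "dist x y"] by auto
    then have "(f x \<bullet> e) * (1 - f y \<bullet> q) \<noteq> (f y \<bullet> e) * (1 - f x \<bullet> q)"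
      using fg(3)[of k] xy by (simp add: separating_def)
    then show False
      using stereo_inner_eq_iff[OF fS(1)[OF xy(1)] fS(1)[OF xy(2)] fS(2)[OF xy(1)] fS(2)[OF xy(2)] e(1)] xy(3) by simp
  qed
  then show thesis using that fg(1,2) by blast
qed

text \<open>\<open>G\<close> is orthogonal to \<open>e\<close>, so the coordinate
  \<open>v \<bullet> e\<close> survives and shearing by \<open>- G\<close> is the inverse;
  boundedness of \<open>G\<close> gives properness.\<close>

lemma shear:
  fixes G :: "real \<Rightarrow> 'a"
  assumes e: "e \<in> H" and G: "continuous_on UNIV G" "\<And>t. G t \<in> H" "\<And>t. G t \<bullet> e = 0" "\<And>t. norm (G t) \<le> B"
  obtains f g where "homeomorphism S S f g" "f q = q" "\<And>v. v \<in> H \<Longrightarrow> f (unstereo q v) = unstereo q (v + G (v \<bullet> e))"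
proof (rule extend_over_pole[of "\<lambda>v. v + G (v \<bullet> e)"])
  show "continuous_on H (\<lambda>v. v + G (v \<bullet> e))"
    by (intro continuous_intros continuous_on_compose2[OF G(1)]) auto
  show "bij_betw (\<lambda>v. v + G (v \<bullet> e)) H H"
    by (rule bij_betw_byWitness[where f' = "\<lambda>v. v - G (v \<bullet> e)"])
       (use G(2) subH in \<open>auto simp: inner_add_left inner_diff_left G(3) image_subset_iff
           intro: subspace_add[OF subV] subspace_diff[OF subV]\<close>)
  show "\<exists>B'. \<forall>v\<in>H. B' \<le> norm v \<longrightarrow> b \<le> norm (v + G (v \<bullet> e))" for b
  proof (intro exI ballI impI)
    fix v :: 'a assume "b + B \<le> norm v"
    moreover have "norm v - norm (- G (v \<bullet> e)) \<le> norm (v - - G (v \<bullet> e))" by (rule norm_triangle_ineq2)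
    ultimately show "b \<le> norm (v + G (v \<bullet> e))" using G(4)[of "v \<bullet> e"] by simp
  qed
qed (rule that)

text \<open>Once the coordinate is injective, the image of \<open>A\<close> in the chart is the
  graph of a continuous map over a compact set of reals. Shearing by the negative of that map,
  extended to all reals, leaves only the \<open>e\<close>-coordinate.\<close>

lemma flatten:
  assumes A: "compact A" "A \<subseteq> S" "q \<notin> A" and \<B>: "cap_basis S A \<B>" and e: "e \<in> H" "norm e = 1"
  obtains f g where "homeomorphism S S f g" "\<And>x. x \<in> A \<Longrightarrow> \<exists>t. f x = unstereo q (t *\<^sub>R e)"
proof -
  obtain f g where fg: "homeomorphism S S f g" "f q = q" and inj: "inj_on (\<lambda>x. stereo q (f x) \<bullet> e) A"
    by (rule generic_injective[OF A \<B> e])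
  have qS: "q \<in> S" using q by simp
  define \<alpha> where "\<alpha> x = stereo q (f x) \<bullet> e" for x
  have fS: "f x \<in> S - {q}" if "x \<in> A" for x
  proof -
    have x: "x \<in> S" "x \<noteq> q" using that A by auto
    have "f x \<in> S" using fg(1) x by (auto simp: homeomorphism_def)
    moreover have "f x \<noteq> q" using homeomorphism_apply1[OF fg(1) x(1)] homeomorphism_apply1[OF fg(1) qS] fg(2) x(2) by metis
    ultimately show ?thesis by simp
  qed
  have cont: "continuous_on A (\<lambda>x. stereo q (f x))"
  proof -
    have "continuous_on A f" using fg(1) A(2) continuous_on_subset by (auto simp: homeomorphism_def)
    moreover have "f ` A \<subseteq> S - {q}" using fS by blast
    ultimately show ?thesis by (rule continuous_on_compose2[OF continuous_stereo])
  qed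
  have "continuous_on A \<alpha>" unfolding \<alpha>_def by (intro continuous_intros cont)
  moreover have "inj_on \<alpha> A" using inj by (simp add: \<alpha>_def[abs_def])
  ultimately obtain \<beta> where \<beta>: "homeomorphism A (\<alpha> ` A) \<alpha> \<beta>" using homeomorphism_compact[OF A(1)] by blast
  \<comment> \<open>This displacement takes the image point with coordinate \<open>t\<close> to the
    line; it is orthogonal to \<open>e\<close> because both ends have the same
    \<open>e\<close>-coordinate.\<close>
  define F where "F t = t *\<^sub>R e - stereo q (f (\<beta> t))" for t
  define L where "L = {v \<in> H. v \<bullet> e = 0}"
  have L: "subspace L" using subH by (auto simp: L_def subspace_def inner_add_left)
  have e1: "e \<bullet> e = 1" using e by (simp add: norm_eq_1)
  have K: "compact (\<alpha> ` A)" using \<open>continuous_on A \<alpha>\<close> A(1) compact_continuous_image by blast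
  have F\<alpha>: "F (\<alpha> x) = \<alpha> x *\<^sub>R e - stereo q (f x)" if "x \<in> A" for x
    using homeomorphism_apply1[OF \<beta> that] by (simp add: F_def)
  have "continuous_on (\<alpha> ` A) F"
  proof -
    have "continuous_on (\<alpha> ` A) \<beta>" "\<beta> ` (\<alpha> ` A) \<subseteq> A" using \<beta> by (auto simp: homeomorphism_def)
    then show ?thesis unfolding F_def by (intro continuous_intros continuous_on_compose2[OF cont])
  qed
  moreover have "F ` (\<alpha> ` A) \<subseteq> L"
  proof
    fix v assume "v \<in> F ` (\<alpha> ` A)"
    then obtain x where x: "x \<in> A" "v = \<alpha> x *\<^sub>R e - stereo q (f x)" using F\<alpha> by auto
    have "v \<in> H" unfolding x(2) using fS[OF x(1)] e(1) subH stereo_H by (intro subspace_diff subspace_scale) auto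
    moreover have "v \<bullet> e = 0" by (simp add: x(2) inner_diff_left e1 \<alpha>_def)
    ultimately show "v \<in> L" by (simp add: L_def)
  qed
  ultimately obtain G B where G: "continuous_on UNIV G" "\<And>t. G t \<in> L" "\<And>t. norm (G t) \<le> B" "\<And>t. t \<in> \<alpha> ` A \<Longrightarrow> G t = F t"
    using Dugundji_bounded[OF K _ L] by metis
  obtain f1 g1 where f1: "homeomorphism S S f1 g1" "f1 q = q" "\<And>v. v \<in> H \<Longrightarrow> f1 (unstereo q v) = unstereo q (v + G (v \<bullet> e))"
  proof -
    have "G t \<in> H" "G t \<bullet> e = 0" for t using G(2)[of t] by (auto simp: L_def)
    then show thesis using shear[OF e(1) G(1) _ _ G(3)] that by blast
  qed
  show thesis
  proof (rule that)
    show "homeomorphism S S (f1 \<circ> f) (g \<circ> g1)" by (rule homeomorphism_compose[OF fg(1) f1(1)])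
    fix x assume x: "x \<in> A"
    have fx: "f x \<in> S" "f x \<noteq> q" using fS[OF x] by auto
    have "f1 (f x) = f1 (unstereo q (stereo q (f x)))" by (simp add: unstereo_stereo[OF fx])
    also have "\<dots> = unstereo q (stereo q (f x) + G (\<alpha> x))" using f1(3)[OF stereo_H[OF fx(1)]] by (simp add: \<alpha>_def)
    also have "\<dots> = unstereo q (\<alpha> x *\<^sub>R e)" using G(4)[of "\<alpha> x"] F\<alpha>[OF x] x by simp
    finally show "\<exists>t. (f1 \<circ> f) x = unstereo q (t *\<^sub>R e)" by auto
  qed
qed

text \<open>The image of the line lies in the span of \<open>q\<close> and \<open>e\<close>, which
  the mirror of the reflection contains.\<close>

lemma reflect_unstereo_line:
  assumes "e \<bullet> w = 0" "q \<bullet> w = 0"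
  shows "reflect w (unstereo q (t *\<^sub>R e)) = unstereo q (t *\<^sub>R e)"
  using assms by (simp add: reflect_def inner_unstereo)

text \<open>Klee's trick: the first shear moves \<open>A\<close> onto the graph of \<open>h\<close>, the second one moves the
  graph onto \<open>Z\<close>.\<close>

lemma klee:
  assumes A: "compact A" "\<And>x. x \<in> A \<Longrightarrow> \<exists>t. x = unstereo q (t *\<^sub>R a)" and Z: "\<And>z. z \<in> Z \<Longrightarrow> \<exists>t. z = unstereo q (t *\<^sub>R b)"
    and h: "homeomorphism A Z h k" and a: "a \<in> H" "norm a = 1" and b: "b \<in> H" "norm b = 1" and ab: "a \<bullet> b = 0"
  obtains f g where "homeomorphism S S f g" "\<And>x. x \<in> A \<Longrightarrow> f x = h x"
proof -
  have n: "a \<bullet> a = 1" "b \<bullet> b = 1" "b \<bullet> a = 0" using a b ab by (auto simp: norm_eq_1 inner_commute)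
  \<comment> \<open>One claim for both shears: \<open>c = 1\<close> adds the
    \<open>b\<close>-coordinate of \<open>h x\<close>; \<open>c = -1\<close>, with \<open>A\<close>,
    \<open>Z\<close> and \<open>a\<close>, \<open>b\<close> exchanged, subtracts the
    \<open>a\<close>-coordinate of \<open>k z\<close>.\<close>
  have step: "\<exists>f g. homeomorphism S S f g \<and> (\<forall>v\<in>H. unstereo q ((v \<bullet> a) *\<^sub>R a) \<in> A \<longrightarrow>
       f (unstereo q v) = unstereo q (v + (c * (stereo q (h (unstereo q ((v \<bullet> a) *\<^sub>R a))) \<bullet> b)) *\<^sub>R b))"
    if A: "compact A" "\<forall>x\<in>A. \<exists>t. x = unstereo q (t *\<^sub>R a)" and Z: "\<forall>z\<in>Z. \<exists>t. z = unstereo q (t *\<^sub>R b)"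
      and h: "continuous_on A h" "h ` A \<subseteq> Z" and a: "a \<in> H" "a \<bullet> a = 1" and b: "b \<in> H" and ab: "b \<bullet> a = 0"
    for A Z a b h and c :: real
  proof -
    have aH: "t *\<^sub>R a \<in> H" "t *\<^sub>R b \<in> H" for t using subspace_scale[OF subH] a(1) b by blast+
    have AS: "A \<subseteq> S - {q}" "Z \<subseteq> S - {q}"
    proof -
      show "A \<subseteq> S - {q}"
      proof
        fix x assume "x \<in> A"
        then obtain t where "x = unstereo q (t *\<^sub>R a)" using A(2) by blast
        then show "x \<in> S - {q}" using unstereo_S[OF aH(1)] unstereo_neq[OF aH(1)] by simp
      qed
      show "Z \<subseteq> S - {q}"
      proof
        fix x assume "x \<in> Z"
        then obtain t where "x = unstereo q (t *\<^sub>R b)" using Z by blast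
        then show "x \<in> S - {q}" using unstereo_S[OF aH(2)] unstereo_neq[OF aH(2)] by simp
      qed
    qed
    define K where "K = (\<lambda>x. stereo q x \<bullet> a) ` A"
    have K: "compact K"
      unfolding K_def using continuous_on_subset[OF continuous_stereo AS(1)]
      by (intro compact_continuous_image A(1) continuous_intros)
    have KA: "unstereo q (t *\<^sub>R a) \<in> A \<longleftrightarrow> t \<in> K" for t
    proof
      have s: "stereo q (unstereo q (t *\<^sub>R a)) \<bullet> a = t" for t
        using stereo_unstereo[OF aH(1)] by (simp add: a(2))
      show "t \<in> K" if "unstereo q (t *\<^sub>R a) \<in> A" unfolding K_def using that s[of t] by force
      assume "t \<in> K"
      then obtain x where x: "x \<in> A" "t = stereo q x \<bullet> a" by (auto simp: K_def)
      then obtain u where u: "x = unstereo q (u *\<^sub>R a)" using A(2) by blast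
      then show "unstereo q (t *\<^sub>R a) \<in> A" using s[of u] x by simp
    qed
    define F where "F t = (c * (stereo q (h (unstereo q (t *\<^sub>R a))) \<bullet> b)) *\<^sub>R b" for t
    have "continuous_on K (\<lambda>t. unstereo q (t *\<^sub>R a))"
      by (intro continuous_on_compose2[OF continuous_unstereo[of UNIV]] continuous_intros) auto
    then have "continuous_on K (\<lambda>t. h (unstereo q (t *\<^sub>R a)))"
      by (rule continuous_on_compose2[OF h(1)]) (use KA in auto)
    then have "continuous_on K (\<lambda>t. stereo q (h (unstereo q (t *\<^sub>R a))))"
    proof (rule continuous_on_compose2[OF continuous_stereo])
      show "(\<lambda>t. h (unstereo q (t *\<^sub>R a))) ` K \<subseteq> S - {q}" using KA h(2) AS(2) by blast
    qed
    then have "continuous_on K F" unfolding F_def by (intro continuous_intros)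
    \<comment> \<open>Extending within \<open>span {b}\<close> keeps the displacement parallel to
      \<open>b\<close>, hence orthogonal to \<open>a\<close>.\<close>
    moreover have "subspace (span {b})" "F ` K \<subseteq> span {b}" by (auto simp: F_def span_base span_scale)
    ultimately obtain G B where G: "continuous_on UNIV G" "\<And>t. G t \<in> span {b}" "\<And>t. norm (G t) \<le> B" "\<And>t. t \<in> K \<Longrightarrow> G t = F t"
      using Dugundji_bounded[OF K] by metis
    have G': "G t \<in> H" "G t \<bullet> a = 0" for t
      using G(2)[of t] aH(2) ab by (auto simp: span_singleton)
    obtain f g where f: "homeomorphism S S f g" "f q = q" "\<And>v. v \<in> H \<Longrightarrow> f (unstereo q v) = unstereo q (v + G (v \<bullet> a))"
      using shear[OF a(1) G(1) G' G(3)] by blast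
    show ?thesis
    proof (intro exI conjI ballI impI)
      show "homeomorphism S S f g" by (rule f(1))
      fix v assume v: "v \<in> H" "unstereo q ((v \<bullet> a) *\<^sub>R a) \<in> A"
      show "f (unstereo q v) = unstereo q (v + (c * (stereo q (h (unstereo q ((v \<bullet> a) *\<^sub>R a))) \<bullet> b)) *\<^sub>R b)"
        using f(3)[OF v(1)] G(4) KA v(2) by (simp add: F_def)
    qed
  qed
  have hk: "continuous_on A h" "h ` A = Z" "continuous_on Z k" "k ` Z = A" using h by (auto simp: homeomorphism_def)
  have "compact Z" using hk A(1) compact_continuous_image by blast
  have A2: "\<forall>x\<in>A. \<exists>t. x = unstereo q (t *\<^sub>R a)" and Z2: "\<forall>z\<in>Z. \<exists>t. z = unstereo q (t *\<^sub>R b)"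
    and hA: "h ` A \<subseteq> Z" and kZ: "k ` Z \<subseteq> A" using A(2) Z hk by auto
  from step[OF A(1) A2 Z2 hk(1) hA a(1) n(1) b(1) n(3), where c = 1]
  obtain f1 g1 where f1: "homeomorphism S S f1 g1" "\<forall>v\<in>H. unstereo q ((v \<bullet> a) *\<^sub>R a) \<in> A \<longrightarrow>
       f1 (unstereo q v) = unstereo q (v + (1 * (stereo q (h (unstereo q ((v \<bullet> a) *\<^sub>R a))) \<bullet> b)) *\<^sub>R b)"
    by (elim exE conjE)
  from step[OF \<open>compact Z\<close> Z2 A2 hk(3) kZ b(1) n(2) a(1) ab, where c = "-1"]
  obtain f2 g2 where f2: "homeomorphism S S f2 g2" "\<forall>v\<in>H. unstereo q ((v \<bullet> b) *\<^sub>R b) \<in> Z \<longrightarrow>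
       f2 (unstereo q v) = unstereo q (v + (-1 * (stereo q (k (unstereo q ((v \<bullet> b) *\<^sub>R b))) \<bullet> a)) *\<^sub>R a)"
    by (elim exE conjE)
  show thesis
  proof (rule that)
    show "homeomorphism S S (f2 \<circ> f1) (g1 \<circ> g2)" by (rule homeomorphism_compose[OF f1(1) f2(1)])
    fix x assume x: "x \<in> A"
    then have hx: "h x \<in> Z" "k (h x) = x" using hk(2) homeomorphism_apply1[OF h] by auto
    obtain t where t: "x = unstereo q (t *\<^sub>R a)" using A(2)[OF x] by blast
    obtain s where s: "h x = unstereo q (s *\<^sub>R b)" using Z[OF hx(1)] by blast
    have ta: "t *\<^sub>R a \<in> H" "s *\<^sub>R b \<in> H" using subspace_scale[OF subH] a(1) b(1) by blast+
    then have tsH: "t *\<^sub>R a + s *\<^sub>R b \<in> H" using subspace_add[OF subH] by blast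
    have i: "(t *\<^sub>R a) \<bullet> a = t" "(t *\<^sub>R a + s *\<^sub>R b) \<bullet> b = s" by (simp_all add: inner_add_left n ab)
    have st: "stereo q (h x) = s *\<^sub>R b" "stereo q x = t *\<^sub>R a"
      by (simp only: s stereo_unstereo[OF ta(2)]) (simp only: t stereo_unstereo[OF ta(1)])
    have "f1 x = unstereo q (t *\<^sub>R a + (1 * (stereo q (h x) \<bullet> b)) *\<^sub>R b)"
      using mp[OF bspec[OF f1(2) ta(1)]] x unfolding i t[symmetric] by blast
    also have "\<dots> = unstereo q (t *\<^sub>R a + s *\<^sub>R b)" unfolding st by (simp add: n)
    finally have 1: "f1 x = unstereo q (t *\<^sub>R a + s *\<^sub>R b)" .
    have "f2 (unstereo q (t *\<^sub>R a + s *\<^sub>R b)) = unstereo q (t *\<^sub>R a + s *\<^sub>R b + (-1 * (stereo q (k (h x)) \<bullet> a)) *\<^sub>R a)"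
      using mp[OF bspec[OF f2(2) tsH]] hx(1) unfolding i s[symmetric] by blast
    also have "\<dots> = unstereo q (s *\<^sub>R b)" unfolding hx(2) st(2) by (simp add: n)
    also have "\<dots> = h x" by (rule s[symmetric])
    finally show "(f2 \<circ> f1) x = h x" using 1 by simp
  qed
qed

text \<open>Klee's trick is applied to the flattened copies and the flattenings are undone. The map
  \<open>u\<close> is returned as well, since conjugating \<open>reflect b\<close> by it gives a
  homeomorphism that fixes \<open>A\<close> pointwise.\<close>

theorem extend_homeomorphism:
  assumes A: "compact A" "A \<subseteq> S" "q \<notin> A" "cap_basis S A \<B>A"
    and Z: "compact Z" "Z \<subseteq> S" "q \<notin> Z" "cap_basis S Z \<B>Z"
    and h: "homeomorphism A Z h k" and ab: "a \<in> H" "norm a = 1" "b \<in> H" "norm b = 1" "a \<bullet> b = 0"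
  obtains f g u v where "homeomorphism S S f g" "\<And>x. x \<in> A \<Longrightarrow> f x = h x"
    "homeomorphism S S u v" "\<And>x. x \<in> A \<Longrightarrow> reflect b (u x) = u x"
proof -
  obtain u v where u: "homeomorphism S S u v" "\<And>x. x \<in> A \<Longrightarrow> \<exists>t. u x = unstereo q (t *\<^sub>R a)"
    using flatten[OF A ab(1,2)] by blast
  obtain u' v' where u': "homeomorphism S S u' v'" "\<And>x. x \<in> Z \<Longrightarrow> \<exists>t. u' x = unstereo q (t *\<^sub>R b)"
    using flatten[OF Z ab(3,4)] by blast
  have hA: "homeomorphism A (u ` A) u v"
    by (rule homeomorphism_of_subsets[OF u(1) A(2) subset_refl refl])
  have hZ: "homeomorphism Z (u' ` Z) u' v'" by (rule homeomorphism_of_subsets[OF u'(1) Z(2) subset_refl refl])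
  have "homeomorphism (u ` A) (u' ` Z) (u' \<circ> (h \<circ> v)) ((u \<circ> k) \<circ> v')"
    by (rule homeomorphism_compose[OF homeomorphism_compose[OF homeomorphism_symD[OF hA] h] hZ])
  moreover have "compact (u ` A)" using hA A(1) by (metis homeomorphism_def compact_continuous_image)
  ultimately have uh: "compact (u ` A)" "homeomorphism (u ` A) (u' ` Z) (u' \<circ> (h \<circ> v)) ((u \<circ> k) \<circ> v')" by simp_all
  obtain f g where f: "homeomorphism S S f g" "\<And>x. x \<in> u ` A \<Longrightarrow> f x = (u' \<circ> (h \<circ> v)) x"
  proof (rule klee[OF uh(1) _ _ uh(2) ab])
    show "\<exists>t. x = unstereo q (t *\<^sub>R a)" if "x \<in> u ` A" for x using that u(2) by auto
    show "\<exists>t. z = unstereo q (t *\<^sub>R b)" if "z \<in> u' ` Z" for z using that u'(2) by auto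
  qed (rule that)
  show thesis
  proof (rule that)
    show "homeomorphism S S (v' \<circ> (f \<circ> u)) ((v \<circ> g) \<circ> u')"
      by (rule homeomorphism_compose[OF homeomorphism_compose[OF u(1) f(1)] homeomorphism_symD[OF u'(1)]])
    show "homeomorphism S S u v" by (rule u(1))
    fix x assume x: "x \<in> A"
    have "h x \<in> Z" using h x by (auto simp: homeomorphism_def)
    then show "(v' \<circ> (f \<circ> u)) x = h x"
      using f(2)[of "u x"] x homeomorphism_apply1[OF hA x] homeomorphism_apply1[OF hZ] by simp
    obtain t where "u x = unstereo q (t *\<^sub>R a)" using u(2)[OF x] by blast
    then show "reflect b (u x) = u x"
      using reflect_unstereo_line[OF ab(5)] ab(3) by (simp add: inner_commute)
  qed
qed

end

section \<open>The extension theorem in an inner product space\<close>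

text \<open>If \<open>A\<close> contained a neighbourhood of \<open>x\<close>, the piece at
  \<open>x\<close> of a fine cover would be open in the sphere, and also closed, being
  \<open>A\<close> minus the other pieces. A great semicircle from \<open>x\<close> to
  \<open>- x\<close> would then stay inside this small piece.\<close>

lemma cap_basis_interior_empty:
  fixes V :: "'a::real_inner set"
  defines "X \<equiv> {x \<in> V. norm x = 1}"
  assumes V: "subspace V" "compact X" and A: "compact A" "A \<subseteq> X" "cap_basis X A \<B>"
    and G: "openin (top_of_set X) G" "x \<in> G" and y: "y \<in> X" "x \<bullet> y = 0"
  shows "\<not> G \<subseteq> A"
proof
  assume GA: "G \<subseteq> A"
  obtain Q where Q: "open Q" "G = X \<inter> Q" using G(1) unfolding openin_open by (elim exE conjE)
  then have "x \<in> Q" "x \<in> X" using G(2) by auto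
  obtain r0 where r0: "0 < r0" "ball x r0 \<subseteq> Q" using Q(1) \<open>x \<in> Q\<close> by (meson openE)
  \<comment> \<open>The bound 1 excludes \<open>- x\<close>, which is at distance 2 from
    \<open>x\<close>, at the end.\<close>
  define r where "r = min r0 1"
  have r: "0 < r" "r \<le> 1" "X \<inter> ball x r \<subseteq> A" using r0 Q(2) GA by (auto simp: r_def)
  have n: "x \<bullet> x = 1" "y \<bullet> y = 1" "y \<bullet> x = 0"
    using \<open>x \<in> X\<close> y by (auto simp: X_def norm_eq_1 inner_commute)
  define c where "c t = cos t *\<^sub>R x + sin t *\<^sub>R y" for t
  have cX: "c t \<in> X" for t
  proof -
    have "c t \<in> V" unfolding c_def using V(1) \<open>x \<in> X\<close> y(1) by (auto simp: X_def intro: subspace_add subspace_scale)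
    moreover have "c t \<bullet> c t = 1"
      by (simp add: c_def inner_add_left inner_add_right n y(2) flip: power2_eq_square)
    ultimately show ?thesis by (simp add: X_def norm_eq_1)
  qed
  have cc: "continuous_on T c" for T unfolding c_def by (intro continuous_intros)
  have "open (c -` ball x r)" using open_vimage[OF open_ball cc] .
  moreover have "0 \<in> c -` ball x r" using r(1) by (simp add: c_def)
  ultimately obtain d where d: "0 < d" "ball 0 d \<subseteq> c -` ball x r" by (meson openE)
  \<comment> \<open>A second point of \<open>A\<close> near \<open>x\<close> is needed to set the
    mesh; \<open>0 < s < pi\<close> makes \<open>sin s\<close> positive, so \<open>c s\<close>
    differs from \<open>x\<close>.\<close>
  define s where "s = min (d / 2) 1"
  have s: "0 < s" "s < pi" using d(1) pi_gt3 by (auto simp: s_def)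
  have "s \<in> ball 0 d" using d(1) by (simp add: s_def min_def)
  then have "c s \<in> ball x r" using d(2) by blast
  then have cs: "c s \<in> A" "dist x (c s) < r" using r(3) cX[of s] by auto
  have "x \<noteq> c s"
  proof
    assume "x = c s"
    then have "y \<bullet> x = y \<bullet> c s" by simp
    then have "sin s = 0" by (simp add: c_def inner_add_right n)
    then show False using sin_gt_zero[OF s] by simp
  qed
  \<comment> \<open>With this mesh the piece at \<open>x\<close> lies within
    \<open>2 * e < r\<close> of \<open>x\<close>, hence inside \<open>A\<close>.\<close>
  define e where "e = dist x (c s) / 2"
  have e: "0 < e" "2 * e < r" "2 * e \<le> dist x (c s)" using \<open>x \<noteq> c s\<close> cs by (auto simp: e_def)
  have xA: "x \<in> A" using r G(2) GA by auto
  obtain J where J: "finite J" "disjoint J" "A \<subseteq> \<Union>J"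
    "\<forall>D\<in>J. openin (top_of_set X) D \<and> D \<noteq> {} \<and> (\<exists>a\<in>A. D \<subseteq> ball a e) \<and> squeezable X A D"
    using caps_cover[OF V(1) V(2)[unfolded X_def] A(1) A(2)[unfolded X_def] A(3)[unfolded X_def] e(1) xA cs(1) e(3)]
    unfolding X_def by blast
  from subsetD[OF J(3) xA] obtain D where D: "D \<in> J" "x \<in> D" by (elim UnionE)
  from bspec[OF J(4) D(1)] obtain a where a: "openin (top_of_set X) D" "D \<subseteq> ball a e" by blast
  have Dx: "dist x z < 2 * e" if "z \<in> D" for z
  proof -
    have "dist x a < e" "dist a z < e" using a(2) that D(2) by (auto simp: dist_commute)
    then show ?thesis using dist_triangle[of x z a] by linarith
  qed
  have DX: "D \<subseteq> X" using openin_imp_subset[OF a(1)] .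
  have DA: "D \<subseteq> A"
  proof
    fix z assume "z \<in> D"
    then show "z \<in> A" using Dx[of z] e(2) r(3) DX by auto
  qed
  have "D = A - \<Union>(J - {D})"
  proof (rule equalityI; rule subsetI)
    fix z assume z: "z \<in> D"
    have "z \<notin> E" if "E \<in> J - {D}" for E
    proof
      assume "z \<in> E"
      have "D \<inter> E = {}" using J(2) D(1) that unfolding disjoint_def by auto
      then show False using z \<open>z \<in> E\<close> by auto
    qed
    then show "z \<in> A - \<Union>(J - {D})" using z DA by auto
  next
    fix z assume "z \<in> A - \<Union>(J - {D})"
    then show "z \<in> D" using J(3) by auto
  qed
  moreover have "openin (top_of_set X) (\<Union>(J - {D}))"
    using J(4) by (intro openin_Union) auto
  then obtain Q' where Q': "open Q'" "\<Union>(J - {D}) = X \<inter> Q'" unfolding openin_open by (elim exE conjE)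
  ultimately have "D = A - Q'" using A(2) by auto
  then have "closed D" using compact_diff[OF A(1) Q'(1)] compact_imp_closed by simp
  define C where "C = c ` {0..pi}"
  have "connected C" unfolding C_def by (intro connected_continuous_image cc) simp
  have CX: "C \<subseteq> X" using cX by (auto simp: C_def)
  obtain P where P: "open P" "D = X \<inter> P" using a(1) unfolding openin_open by (elim exE conjE)
  have "openin (top_of_set C) (C \<inter> D)"
    using P CX by (metis (no_types, lifting) Int_absorb2 inf_assoc openin_open_Int)
  moreover have "closedin (top_of_set C) (C \<inter> D)" using \<open>closed D\<close> by (rule closedin_closed_Int)
  ultimately have "C \<inter> D = {} \<or> C \<inter> D = C" using \<open>connected C\<close> unfolding connected_clopen by blast
  moreover have "c 0 \<in> C" "c pi \<in> C" unfolding C_def by auto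
  moreover have "c 0 \<in> D" using D(2) by (simp add: c_def)
  ultimately have "c pi \<in> D" by auto
  then have "- x \<in> D" by (simp add: c_def)
  then have "dist x (- x) < 1" using Dx[of "- x"] e(2) r(2) by auto
  moreover have "dist x (- x) = 2"
  proof -
    have "x - - x = 2 *\<^sub>R x" by (simp add: scaleR_2)
    then have "dist x (- x) = 2 * norm x" unfolding dist_norm by simp
    then show ?thesis using \<open>x \<in> X\<close> by (simp add: X_def)
  qed
  ultimately show False by simp
qed

section \<open>Hyperplane reflections and orthonormal frames\<close>

lemma reflect_reflect:
  assumes "norm w = 1" shows "reflect w (reflect w x) = x"
  using assms by (simp add: reflect_def inner_diff_left norm_eq_1 algebra_simps)

lemma inner_reflect:
  assumes "norm w = 1" shows "reflect w x \<bullet> reflect w y = x \<bullet> y"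
proof -
  have "w \<bullet> w = 1" using assms by (simp add: norm_eq_1)
  then show ?thesis by (simp add: reflect_def inner_diff_left inner_diff_right inner_commute algebra_simps)
qed

lemma reflect_subspace: "subspace V \<Longrightarrow> w \<in> V \<Longrightarrow> x \<in> V \<Longrightarrow> reflect w x \<in> V"
  unfolding reflect_def by (intro subspace_diff subspace_scale)

lemma continuous_reflect: "continuous_on X (reflect w)"
  unfolding reflect_def by (intro continuous_intros)

lemma homeomorphism_reflect:
  assumes "subspace V" "w \<in> V" "norm w = 1"
  shows "homeomorphism {x \<in> V. norm x = 1} {x \<in> V. norm x = 1} (reflect w) (reflect w)"
proof -
  have "norm (reflect w x) = norm x" for x
    using inner_reflect[OF assms(3)] by (simp add: norm_eq_sqrt_inner)
  then show ?thesis
    using assms reflect_reflect[OF assms(3)]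
    by (intro homeomorphismI) (auto simp: continuous_reflect reflect_subspace)
qed

text \<open>The mirror is the perpendicular bisector of \<open>u\<close> and \<open>v\<close>, which
  passes through the origin because both have norm 1.\<close>

lemma reflection_swap:
  assumes "subspace V" "u \<in> V" "v \<in> V" "norm u = 1" "norm v = 1" "u \<noteq> v"
  obtains w where "w \<in> V" "norm w = 1" "reflect w u = v"
proof -
  define w where "w = (1 / norm (u - v)) *\<^sub>R (u - v)"
  have n: "norm (u - v) > 0" using assms(6) by simp
  have "w \<in> V" unfolding w_def using assms(1-3) by (intro subspace_scale subspace_diff)
  moreover have "norm w = 1" using n by (simp add: w_def)
  moreover have "reflect w u = v"
  proof -
    have "2 * (u \<bullet> (u - v)) = (norm (u - v))\<^sup>2"
      using assms(4,5) by (simp add: power2_norm_eq_inner inner_diff_left inner_diff_right norm_eq_1 inner_commute)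
    then have "(2 * (u \<bullet> w)) *\<^sub>R w = u - v"
      using n by (simp add: w_def power2_eq_square)
    then show ?thesis by (simp add: reflect_def)
  qed
  ultimately show thesis using that by blast
qed

text \<open>A reflection taking \<open>e0\<close> to \<open>q\<close> carries \<open>e1\<close> and
  \<open>e2\<close> to the required pair. The three given vectors express the dimension bound
  without coordinates.\<close>

lemma orthonormal_frame:
  assumes V: "subspace V" "e0 \<in> V" "e1 \<in> V" "e2 \<in> V" and n: "norm e0 = 1" "norm e1 = 1" "norm e2 = 1"
    and o: "e0 \<bullet> e1 = 0" "e0 \<bullet> e2 = 0" "e1 \<bullet> e2 = 0" and q: "q \<in> V" "norm q = 1"
  obtains a b where "a \<in> V" "b \<in> V" "norm a = 1" "norm b = 1" "a \<bullet> q = 0" "b \<bullet> q = 0" "a \<bullet> b = 0"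
proof (cases "q = e0")
  case True
  then show thesis using that[of e1 e2] assms by (simp add: inner_commute)
next
  case False
  obtain w where w: "w \<in> V" "norm w = 1" "reflect w e0 = q"
    using reflection_swap[OF V(1,2) q(1) n(1) q(2)] False by metis
  have "norm (reflect w x) = norm x" for x
    using inner_reflect[OF w(2)] by (simp add: norm_eq_sqrt_inner)
  then have n': "norm (reflect w e1) = 1" "norm (reflect w e2) = 1" using n by simp_all
  have o': "reflect w e1 \<bullet> q = 0" "reflect w e2 \<bullet> q = 0" "reflect w e1 \<bullet> reflect w e2 = 0"
    unfolding w(3)[symmetric] inner_reflect[OF w(2)] using o by (simp_all add: inner_commute)
  show thesis
    by (rule that[OF reflect_subspace[OF V(1) w(1) V(3)] reflect_subspace[OF V(1) w(1) V(4)] n' o'])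
qed

theorem extend_homeomorphism_between_cap_compacta:
  fixes V :: "'a::real_inner set"
  defines "X \<equiv> {x \<in> V. norm x = 1}"
  assumes V: "subspace V" "compact X" "e0 \<in> V" "e1 \<in> V" "e2 \<in> V" and n: "norm e0 = 1" "norm e1 = 1" "norm e2 = 1"
    and o: "e0 \<bullet> e1 = 0" "e0 \<bullet> e2 = 0" "e1 \<bullet> e2 = 0"
    and A: "compact A" "A \<subseteq> X" "cap_basis X A \<B>A" and Z: "compact Z" "Z \<subseteq> X" "cap_basis X Z \<B>Z"
    and h: "homeomorphism A Z h k"
  obtains f g u v b where "homeomorphism X X f g" "\<forall>x\<in>A. f x = h x"
    "homeomorphism X X u v" "\<forall>x\<in>A. reflect b (u x) = u x" "b \<in> V" "norm b = 1"
proof -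
  have thin: "\<not> G \<subseteq> K" if "openin (top_of_set X) G" "x \<in> G" "compact K" "K \<subseteq> X" "cap_basis X K \<B>" for G x K \<B>
  proof -
    have "x \<in> X" using openin_imp_subset[OF that(1)] that(2) by auto
    then obtain y where "y \<in> V" "norm y = 1" "y \<bullet> x = 0"
      using orthonormal_frame[OF V(1,3-5) n o, of x] by (auto simp: X_def)
    then have y: "y \<in> X" "x \<bullet> y = 0" by (auto simp: X_def inner_commute)
    show ?thesis
      using cap_basis_interior_empty[OF V(1) V(2)[unfolded X_def] that(3) that(4,5,1)[unfolded X_def] that(2) y[unfolded X_def]] .
  qed
  have "e0 \<in> X" using V n by (simp add: X_def)
  \<comment> \<open>\<open>thin\<close> is applied first to the whole sphere and \<open>A\<close>,
    then to the nonempty open complement of \<open>A\<close> and \<open>Z\<close>; this yields a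
    pole outside both.\<close>
  then have "\<not> X \<subseteq> A" using thin[OF openin_subtopology_self _ A] by blast
  then obtain x where x: "x \<in> X - A" by blast
  have "openin (top_of_set X) (X - A)"
  proof -
    have "open (- A)" using compact_imp_closed[OF A(1)] by auto
    moreover have "X - A = X \<inter> - A" by auto
    ultimately show ?thesis by (metis openin_open_Int)
  qed
  then have "\<not> X - A \<subseteq> Z" using thin[OF _ x Z] by blast
  then obtain p where p: "p \<in> X" "p \<notin> A" "p \<notin> Z" by blast
  then have pV: "p \<in> V" "norm p = 1" by (auto simp: X_def)
  obtain a b where ab: "a \<in> V" "b \<in> V" "norm a = 1" "norm b = 1" "a \<bullet> p = 0" "b \<bullet> p = 0" "a \<bullet> b = 0"
    by (rule orthonormal_frame[OF V(1,3-5) n o pV])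
  interpret pole V p using V pV by unfold_locales (auto simp: X_def)
  have H: "a \<in> H" "b \<in> H" using ab by auto
  show thesis
  proof (rule extend_homeomorphism[OF A(1) A(2)[unfolded X_def] p(2) A(3)[unfolded X_def]
          Z(1) Z(2)[unfolded X_def] p(3) Z(3)[unfolded X_def] h H(1) ab(3) H(2) ab(4,7)])
    fix f g u v assume fu: "homeomorphism S S f g" "\<And>x. x \<in> A \<Longrightarrow> f x = h x"
      "homeomorphism S S u v" "\<And>x. x \<in> A \<Longrightarrow> reflect b (u x) = u x"
    show thesis
      by (rule that[OF fu(1)[folded X_def] _ fu(3)[folded X_def] _ ab(2,4)]) (use fu(2,4) in auto)
  qed
qed

section \<open>Finitely supported sequences\<close>

text \<open>One inner product space that contains the spheres of all dimensions: \<open>n\<close> is a variable of the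
  theorem, so it cannot be the dimension of a Euclidean space type.\<close>

typedef fseq = "{f :: nat \<Rightarrow> real. finite {i. f i \<noteq> 0}}" morphisms coord Fseq
  by (rule exI[of _ "\<lambda>_. 0"]) simp

lemma finite_support_coord: "finite {i. coord x i \<noteq> 0}"
  using coord[of x] by simp

lemma coord_Fseq: "finite {i. f i \<noteq> 0} \<Longrightarrow> coord (Fseq f) = f"
  by (simp add: Fseq_inverse)

lemma fseq_eqI: "(\<And>i. coord x i = coord y i) \<Longrightarrow> x = y"
  by (metis coord_inject ext)

instantiation fseq :: real_vector
begin

definition "0 = Fseq (\<lambda>_. 0)"
definition "x + y = Fseq (\<lambda>i. coord x i + coord y i)"
definition "x - y = Fseq (\<lambda>i. coord x i - coord y i)"
definition "- x = Fseq (\<lambda>i. - coord x i)"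
definition "r *\<^sub>R x = Fseq (\<lambda>i. r * coord x i)"

lemma coord_simps [simp]:
  "coord 0 i = 0" "coord (x + y) i = coord x i + coord y i" "coord (x - y) i = coord x i - coord y i"
  "coord (- x) i = - coord x i" "coord (r *\<^sub>R x) i = r * coord x i"
proof -
  have "finite ({i. coord x i \<noteq> 0} \<union> {i. coord y i \<noteq> 0})" by (simp add: finite_support_coord)
  then have "finite {i. coord x i + coord y i \<noteq> 0}" "finite {i. coord x i - coord y i \<noteq> 0}"
    by (rule rev_finite_subset, force)+
  then show "coord (x + y) i = coord x i + coord y i" "coord (x - y) i = coord x i - coord y i"
    by (simp_all add: plus_fseq_def minus_fseq_def coord_Fseq)
  have "finite {i. r * coord x i \<noteq> 0}" using finite_support_coord[of x] by (auto elim!: rev_finite_subset)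
  then show "coord (r *\<^sub>R x) i = r * coord x i" by (simp add: scaleR_fseq_def coord_Fseq)
qed (simp_all add: zero_fseq_def uminus_fseq_def coord_Fseq finite_support_coord)

instance
  by standard (auto intro!: fseq_eqI simp: algebra_simps)

end

instantiation fseq :: real_inner
begin

definition "inner x y = (\<Sum>i | coord x i \<noteq> 0. coord x i * coord y i)"
definition "norm (x :: fseq) = sqrt (inner x x)"
definition "dist (x :: fseq) y = norm (x - y)"
definition "sgn (x :: fseq) = x /\<^sub>R norm x"
definition "(uniformity :: (fseq \<times> fseq) filter) = (INF e\<in>{0<..}. principal {(x, y). dist x y < e})"
definition "open (U :: fseq set) \<longleftrightarrow> (\<forall>x\<in>U. \<forall>\<^sub>F (x', y) in uniformity. x' = x \<longrightarrow> y \<in> U)"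

text \<open>The defining sum runs over the support of the first argument; a common finite index set
  makes symmetry and linearity termwise.\<close>

lemma inner_fseq_sum:
  "finite I \<Longrightarrow> {i. coord x i \<noteq> 0} \<subseteq> I \<Longrightarrow> inner x y = (\<Sum>i\<in>I. coord x i * coord y i)"
  unfolding inner_fseq_def by (rule sum.mono_neutral_left) auto

instance
proof
  fix x y z :: fseq and r :: real
  let ?s = "\<lambda>x. {i. coord x i \<noteq> 0}"
  have fin: "finite (?s x \<union> ?s y \<union> ?s z \<union> ?s (x + y) \<union> ?s (r *\<^sub>R x))" (is "finite ?I")
    by (intro finite_UnI finite_support_coord)
  have I: "?s x \<subseteq> ?I" "?s y \<subseteq> ?I" "?s (x + y) \<subseteq> ?I" "?s (r *\<^sub>R x) \<subseteq> ?I" by blast+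
  note s = inner_fseq_sum[OF fin I(1)] inner_fseq_sum[OF fin I(2)] inner_fseq_sum[OF fin I(3)] inner_fseq_sum[OF fin I(4)]
  show "inner x y = inner y x" unfolding s by (simp add: mult.commute)
  show "inner (x + y) z = inner x z + inner y z" unfolding s by (simp add: sum.distrib distrib_right)
  show "inner (r *\<^sub>R x) y = r * inner x y" unfolding s by (simp add: sum_distrib_left mult.assoc)
  show "0 \<le> inner x x" unfolding s by (simp add: sum_nonneg)
  show "inner x x = 0 \<longleftrightarrow> x = 0"
  proof
    assume "inner x x = 0"
    then have "\<forall>i\<in>?s x. coord x i * coord x i = 0"
      unfolding inner_fseq_def by (subst (asm) sum_nonneg_eq_0_iff) (auto simp: finite_support_coord)
    then show "x = 0" by (intro fseq_eqI) auto
  qed (simp add: inner_fseq_def)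
qed (simp_all add: norm_fseq_def dist_fseq_def sgn_fseq_def uniformity_fseq_def open_fseq_def)

end

definition fseq_basis :: "nat \<Rightarrow> fseq" where
  "fseq_basis k = Fseq (\<lambda>i. if i = k then 1 else 0)"

lemma coord_fseq_basis: "coord (fseq_basis k) i = (if i = k then 1 else 0)"
  by (simp add: fseq_basis_def coord_Fseq)

lemma inner_fseq_basis: "x \<bullet> fseq_basis k = coord x k"
proof -
  have "x \<bullet> fseq_basis k = (\<Sum>i\<in>{k}. coord (fseq_basis k) i * coord x i)"
    unfolding inner_commute[of x] by (rule inner_fseq_sum) (auto simp: coord_fseq_basis)
  then show ?thesis by (simp add: coord_fseq_basis)
qed

lemma norm_fseq_basis: "norm (fseq_basis k) = 1"
  by (simp add: norm_eq_1 inner_fseq_basis coord_fseq_basis)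

definition fseq_upto :: "nat \<Rightarrow> fseq set" where
  "fseq_upto n = {x. \<forall>i>n. coord x i = 0}"

abbreviation fseq_sphere :: "nat \<Rightarrow> fseq set" where
  "fseq_sphere n \<equiv> {x \<in> fseq_upto n. norm x = 1}"

lemma subspace_fseq_upto: "subspace (fseq_upto n)"
  by (auto simp: subspace_def fseq_upto_def)

lemma fseq_basis_upto: "k \<le> n \<Longrightarrow> fseq_basis k \<in> fseq_upto n"
  by (auto simp: fseq_upto_def coord_fseq_basis)

lemma inner_fseq_upto: "x \<in> fseq_upto n \<Longrightarrow> x \<bullet> y = (\<Sum>i\<le>n. coord x i * coord y i)"
  by (rule inner_fseq_sum) (auto simp: fseq_upto_def intro: ccontr)

lemma coord_sum: "coord (\<Sum>i\<in>I. f i) j = (\<Sum>i\<in>I. coord (f i) j)"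
  by (induction I rule: infinite_finite_induct) auto

section \<open>The standard sphere as a unit sphere of finitely supported sequences\<close>

lemma nsphere_eq: "nsphere n = top_of_set (topspace (nsphere n))"
proof -
  have "nsphere n = top_of_set {x. (\<Sum>i\<le>n. x i ^ 2) = 1 \<and> (\<forall>i>n. x i = 0)}"
    unfolding nsphere euclidean_product_topology ..
  then show ?thesis by simp
qed

lemma coord_Fseq_nsphere:
  assumes "x \<in> topspace (nsphere n)" shows "coord (Fseq x) = x"
proof (rule coord_Fseq)
  have "{i. x i \<noteq> 0} \<subseteq> {..n}" using assms unfolding topspace_nsphere_iff by (auto simp: not_less[symmetric])
  then show "finite {i. x i \<noteq> 0}" using finite_subset by blast
qed

lemma Fseq_nsphere:
  assumes x: "x \<in> topspace (nsphere n)" shows "Fseq x \<in> fseq_sphere n"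
proof -
  have "Fseq x \<in> fseq_upto n" using x by (simp add: fseq_upto_def coord_Fseq_nsphere[OF x] topspace_nsphere_iff)
  moreover from inner_fseq_upto[OF this, of "Fseq x"] have "Fseq x \<bullet> Fseq x = 1"
    using x by (simp add: coord_Fseq_nsphere[OF x] topspace_nsphere_iff power2_eq_square)
  ultimately show ?thesis by (simp add: norm_eq_1)
qed

lemma coord_nsphere:
  assumes x: "x \<in> fseq_sphere n" shows "coord x \<in> topspace (nsphere n)"
proof -
  have "x \<bullet> x = 1" and n: "x \<in> fseq_upto n" using x by (auto simp: norm_eq_1)
  then have "(\<Sum>i\<le>n. coord x i * coord x i) = 1" using inner_fseq_upto[OF n, of x] by simp
  then show ?thesis using n unfolding topspace_nsphere_iff fseq_upto_def power2_eq_square by simp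
qed

text \<open>Product and norm topology agree here: \<open>Fseq\<close> is a finite sum of coordinates
  times basis vectors, and each component of \<open>coord\<close> is an inner product with a basis
  vector.\<close>

lemma homeomorphism_nsphere: "homeomorphism (topspace (nsphere n)) (fseq_sphere n) Fseq coord"
proof (rule homeomorphismI)
  have "continuous_on (topspace (nsphere n)) (\<lambda>x. \<Sum>i\<le>n. x i *\<^sub>R fseq_basis i)"
    by (intro continuous_intros continuous_on_subset[OF continuous_on_product_coordinates] subset_UNIV)
  moreover have "(\<Sum>i\<le>n. x i *\<^sub>R fseq_basis i) = Fseq x" if x: "x \<in> topspace (nsphere n)" for x
  proof (rule fseq_eqI)
    fix j
    have "coord (\<Sum>i\<le>n. x i *\<^sub>R fseq_basis i) j = (\<Sum>i\<le>n. x i * (if j = i then 1 else 0))"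
      by (simp add: coord_sum coord_fseq_basis)
    also have "\<dots> = (if j \<le> n then x j else 0)" by (simp add: if_distrib cong: if_cong)
    also have "\<dots> = coord (Fseq x) j" using x by (simp add: coord_Fseq_nsphere[OF x] topspace_nsphere_iff)
    finally show "coord (\<Sum>i\<le>n. x i *\<^sub>R fseq_basis i) j = coord (Fseq x) j" .
  qed
  ultimately show "continuous_on (topspace (nsphere n)) Fseq" by (simp cong: continuous_on_cong)
  show "continuous_on (fseq_sphere n) coord"
    by (rule continuous_on_coordinatewise_then_product) (intro continuous_intros | simp flip: inner_fseq_basis)+
  show "Fseq ` topspace (nsphere n) \<subseteq> fseq_sphere n" using Fseq_nsphere by (rule image_subsetI)
  show "coord ` fseq_sphere n \<subseteq> topspace (nsphere n)" using coord_nsphere by (rule image_subsetI)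
qed (simp_all only: coord_Fseq_nsphere coord_inverse)

text \<open>The sphere is closed in the product of intervals \<open>{-1..1}\<close>, which is
  compact by Tychonoff's theorem.\<close>

lemma compact_nsphere: "compact (topspace (nsphere n))"
proof -
  let ?K = "PiE UNIV (\<lambda>_::nat. {-1..1::real})"
  have "compactin (powertop_real UNIV) ?K"
    by (subst compactin_PiE) auto
  then have c: "compact ?K" unfolding euclidean_product_topology by simp
  have cont: "continuous_on UNIV (\<lambda>x::nat \<Rightarrow> real. x i)" for i by (rule continuous_on_product_coordinates)
  have "topspace (nsphere n) = {x. (\<Sum>i\<le>n. (x i)\<^sup>2) = 1} \<inter> (\<Inter>i\<in>{n<..}. {x. x i = 0})"
    by (auto simp: topspace_nsphere_iff)
  moreover have "closed {x::nat \<Rightarrow> real. (\<Sum>i\<le>n. (x i)\<^sup>2) = 1}"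
    by (intro closed_Collect_eq continuous_intros cont)
  moreover have "closed (\<Inter>i\<in>{n<..}. {x::nat \<Rightarrow> real. x i = 0})"
    by (intro closed_INT ballI closed_Collect_eq cont continuous_on_const)
  ultimately have "closed (topspace (nsphere n))" by (metis closed_Int)
  then have "compact (?K \<inter> topspace (nsphere n))" using c by (rule compact_Int_closed[rotated])
  moreover have "?K \<inter> topspace (nsphere n) = topspace (nsphere n)"
  proof -
    have "x i \<in> {-1..1}" if "x \<in> topspace (nsphere n)" for x i
      using topspace_nsphere_1[OF that, of i] by (simp add: abs_square_le_1 abs_le_iff)
    then show ?thesis by auto
  qed
  ultimately show ?thesis by simp
qed

lemma compact_fseq_sphere: "compact (fseq_sphere n)"
proof -
  note h = homeomorphism_nsphere[of n]
  show ?thesis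
    using compact_continuous_image[OF homeomorphism_cont1[OF h] compact_nsphere] homeomorphism_image1[OF h] by simp
qed

section \<open>Transfer to the standard sphere\<close>

lemma inner_Fseq:
  assumes "x \<in> topspace (nsphere n)" "y \<in> topspace (nsphere n)"
  shows "Fseq x \<bullet> Fseq y = (\<Sum>i\<le>n. x i * y i)"
  using inner_fseq_upto[of "Fseq x" n "Fseq y"] Fseq_nsphere[OF assms(1)]
  by (simp add: coord_Fseq_nsphere[OF assms(1)] coord_Fseq_nsphere[OF assms(2)])

lemma inj_on_Fseq: "inj_on Fseq (topspace (nsphere n))"
  by (rule inj_on_inverseI[of _ coord]) (rule coord_Fseq_nsphere)

text \<open>On the sphere the squared chordal distance is 2 minus twice the inner product. For
  \<open>r > 2\<close> the threshold falls below -1 and the cap is the whole sphere.\<close>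

lemma cap_of_ball:
  assumes "ball_on_sphere n U"
  shows "\<exists>c t. Fseq ` U = cap (fseq_sphere n) c t"
proof -
  obtain x r where x: "x \<in> topspace (nsphere n)" and r: "r > 0"
    and U: "U = Metric_space.mball (topspace (nsphere n)) (sphere_dist n) x r"
    using assms unfolding ball_on_sphere_def by blast
  have iff: "y \<in> U \<longleftrightarrow> 1 - r\<^sup>2 / 2 < Fseq x \<bullet> Fseq y" if y: "y \<in> topspace (nsphere n)" for y
  proof -
    have "y \<in> U \<longleftrightarrow> sqrt (2 - 2 * (\<Sum>i\<le>n. x i * y i)) < r"
      using x y by (simp add: U Metric_space.in_mball[OF Metric_space_sphere] sphere_inner_bounds(1))
    also have "\<dots> \<longleftrightarrow> 2 - 2 * (\<Sum>i\<le>n. x i * y i) < r\<^sup>2"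
      using r by (metis abs_of_pos real_sqrt_abs real_sqrt_less_iff)
    finally show ?thesis unfolding inner_Fseq[OF x y] by auto
  qed
  have US: "U \<subseteq> topspace (nsphere n)"
    unfolding U by (rule Metric_space.mball_subset_mspace[OF Metric_space_sphere])
  have "Fseq ` U = cap (fseq_sphere n) (Fseq x) (1 - r\<^sup>2 / 2)"
  proof (rule equalityI; rule subsetI)
    fix z assume "z \<in> Fseq ` U"
    then obtain y where y: "y \<in> U" "z = Fseq y" by blast
    then show "z \<in> cap (fseq_sphere n) (Fseq x) (1 - r\<^sup>2 / 2)"
      using US iff[of y] Fseq_nsphere[of y n] by (auto simp: cap_def)
  next
    fix z assume z: "z \<in> cap (fseq_sphere n) (Fseq x) (1 - r\<^sup>2 / 2)"
    then have "coord z \<in> topspace (nsphere n)" using coord_nsphere[of z n] by (auto simp: cap_def)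
    then have "coord z \<in> U" using iff z by (simp add: coord_inverse cap_def)
    then show "z \<in> Fseq ` U" using coord_inverse[of z] by force
  qed
  then show ?thesis by blast
qed

lemma subtopology_nsphere_eq:
  assumes "A \<subseteq> topspace (nsphere n)"
  shows "subtopology (nsphere n) A = top_of_set A"
  by (metis assms inf.absorb_iff2 nsphere_eq subtopology_subtopology)

lemma cap_basis_of_nested_ball_basis:
  assumes A: "A \<subseteq> topspace (nsphere n)" and \<B>: "nested_ball_basis n A \<B>"
  shows "cap_basis (fseq_sphere n) (Fseq ` A) ((`) Fseq ` \<B>)"
proof -
  have ball: "ball_on_sphere n U" if "U \<in> \<B>" for U
    using \<B> that by (simp add: nested_ball_basis_def)
  have sub: "U \<subseteq> topspace (nsphere n)" if U: "U \<in> \<B>" for U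
  proof -
    have "openin (nsphere n) U" using \<B> U by (simp add: nested_ball_basis_def nested_in_def)
    then show ?thesis by (rule openin_subset)
  qed
  have nested: "U \<inter> W = {} \<or> U \<subseteq> W \<or> W \<subseteq> U" if UW: "U \<in> \<B>" "W \<in> \<B>" for U W
  proof -
    have "nsphere n closure_of U \<inter> nsphere n closure_of W = {} \<or> U \<subseteq> W \<or> W \<subseteq> U"
      using \<B> UW by (simp add: nested_ball_basis_def nested_in_def)
    then show ?thesis using closure_of_subset[OF sub[OF UW(1)]] closure_of_subset[OF sub[OF UW(2)]] by blast
  qed
  have basis: "\<exists>U\<in>\<B>. a \<in> U \<and> U \<inter> A \<subseteq> Fseq -` ball (Fseq a) e" if a: "a \<in> A" and e: "0 < e" for a e
  proof -
    \<comment> \<open>This set is open in \<open>A\<close> by continuity of \<open>Fseq\<close>, so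
      it is a union of traces; the one containing \<open>a\<close> is taken.\<close>
    let ?Q = "A \<inter> Fseq -` ball (Fseq a) e"
    have "continuous_on A Fseq" using continuous_on_subset[OF homeomorphism_cont1[OF homeomorphism_nsphere] A] .
    then have "openin (top_of_set A) ?Q" by (rule continuous_openin_preimage_gen) simp
    moreover have "basis_of_topology (top_of_set A) {U \<inter> A | U. U \<in> \<B>}"
      using \<B> unfolding nested_ball_basis_def subtopology_nsphere_eq[OF A] by simp
    ultimately obtain B' where B': "B' \<subseteq> {U \<inter> A | U. U \<in> \<B>}" "\<Union>B' = ?Q"
      unfolding basis_of_topology_def by meson
    have "a \<in> \<Union>B'" using B'(2) a e by simp
    then obtain T where T: "T \<in> B'" "a \<in> T" by (elim UnionE)
    then obtain U where U: "U \<in> \<B>" "T = U \<inter> A" using B'(1) by auto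
    have "T \<subseteq> ?Q" using T(1) B'(2) by auto
    then show ?thesis using U T(2) by (intro bexI[of _ U]) auto
  qed
  show ?thesis
    unfolding cap_basis_def
  proof (intro conjI ballI allI impI)
    show "\<exists>c t. U' = cap (fseq_sphere n) c t" if "U' \<in> (`) Fseq ` \<B>" for U'
    proof -
      from that obtain U where "U \<in> \<B>" "U' = Fseq ` U" by (elim imageE)
      then show ?thesis using cap_of_ball[OF ball] by simp
    qed
    show "U' \<inter> W' = {} \<or> U' \<subseteq> W' \<or> W' \<subseteq> U'" if UW: "U' \<in> (`) Fseq ` \<B>" "W' \<in> (`) Fseq ` \<B>" for U' W'
    proof -
      from UW(1) obtain U where U: "U \<in> \<B>" "U' = Fseq ` U" by (elim imageE)
      from UW(2) obtain W where W: "W \<in> \<B>" "W' = Fseq ` W" by (elim imageE)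
      have "Fseq ` U \<inter> Fseq ` W = Fseq ` (U \<inter> W)"
        using inj_on_image_Int[OF inj_on_Fseq sub[OF U(1)] sub[OF W(1)]] by simp
      then show ?thesis using nested[OF U(1) W(1)] unfolding U(2) W(2) by auto
    qed
    show "\<exists>U'\<in>(`) Fseq ` \<B>. a' \<in> U' \<and> U' \<inter> Fseq ` A \<subseteq> ball a' e" if a': "a' \<in> Fseq ` A" and e: "0 < e" for a' e
    proof -
      from a' obtain a where a: "a \<in> A" "a' = Fseq a" by (elim imageE)
      obtain U where U: "U \<in> \<B>" "a \<in> U" "U \<inter> A \<subseteq> Fseq -` ball (Fseq a) e" using basis[OF a(1) e] by blast
      have "Fseq ` U \<inter> Fseq ` A = Fseq ` (U \<inter> A)"
        using inj_on_image_Int[OF inj_on_Fseq sub[OF U(1)] A] by simp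
      then show ?thesis using U a(2) by (intro bexI[of _ "Fseq ` U"]) auto
    qed
  qed
qed

section \<open>Degrees of self-homeomorphisms of the sphere\<close>

lemma homeomorphic_maps_top_of_set:
  "homeomorphic_maps (top_of_set X) (top_of_set Y) f g \<longleftrightarrow> homeomorphism X Y f g"
proof
  assume "homeomorphic_maps (top_of_set X) (top_of_set Y) f g"
  then show "homeomorphism X Y f g"
    by (intro homeomorphismI) (auto simp: homeomorphic_maps_def image_subset_iff Pi_iff)
qed (auto simp: homeomorphic_maps_def homeomorphism_def)

definition sphere_degree :: "nat \<Rightarrow> (fseq \<Rightarrow> fseq) \<Rightarrow> int" where
  "sphere_degree n f = Brouwer_degree2 n (coord \<circ> f \<circ> Fseq)"

lemma homeomorphic_map_nsphere_conj:
  assumes "homeomorphism (fseq_sphere n) (fseq_sphere n) f g"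
  shows "homeomorphic_maps (nsphere n) (nsphere n) (coord \<circ> f \<circ> Fseq) (coord \<circ> g \<circ> Fseq)"
proof -
  note h = homeomorphism_nsphere[of n]
  have "homeomorphism (topspace (nsphere n)) (topspace (nsphere n)) (coord \<circ> (f \<circ> Fseq)) ((coord \<circ> g) \<circ> Fseq)"
    by (rule homeomorphism_compose[OF homeomorphism_compose[OF h assms] homeomorphism_symD[OF h]])
  then show ?thesis
    unfolding homeomorphic_maps_top_of_set[symmetric] nsphere_eq[symmetric] comp_assoc .
qed

lemma sphere_degree_compose:
  assumes f: "homeomorphism (fseq_sphere n) (fseq_sphere n) f f'" and g: "homeomorphism (fseq_sphere n) (fseq_sphere n) g g'"
  shows "sphere_degree n (g \<circ> f) = sphere_degree n g * sphere_degree n f"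
proof -
  have "Brouwer_degree2 n ((coord \<circ> g \<circ> Fseq) \<circ> (coord \<circ> f \<circ> Fseq)) = sphere_degree n g * sphere_degree n f"
    unfolding sphere_degree_def
    using homeomorphic_map_nsphere_conj[OF f] homeomorphic_map_nsphere_conj[OF g]
    by (intro Brouwer_degree2_compose) (auto simp: homeomorphic_maps_def)
  then show ?thesis unfolding sphere_degree_def by (simp add: comp_def coord_inverse)
qed

lemma sphere_degree_cong:
  assumes "\<And>x. x \<in> fseq_sphere n \<Longrightarrow> f x = g x"
  shows "sphere_degree n f = sphere_degree n g"
  unfolding sphere_degree_def using assms[OF Fseq_nsphere] by (intro Brouwer_degree2_eq) simp

lemma sphere_degree_inverse:
  assumes "homeomorphism (fseq_sphere n) (fseq_sphere n) f g"
  shows "sphere_degree n g * sphere_degree n f = 1"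
proof -
  have "sphere_degree n g * sphere_degree n f = sphere_degree n (g \<circ> f)"
    using sphere_degree_compose[OF assms homeomorphism_symD[OF assms]] by simp
  also have "\<dots> = sphere_degree n (\<lambda>x. x)"
    using homeomorphism_apply1[OF assms] by (intro sphere_degree_cong) simp
  also have "\<dots> = Brouwer_degree2 n id"
    unfolding sphere_degree_def using coord_Fseq_nsphere by (intro Brouwer_degree2_eq) simp
  finally show ?thesis by simp
qed

lemma abs_sphere_degree:
  assumes "homeomorphism (fseq_sphere n) (fseq_sphere n) f g"
  shows "\<bar>sphere_degree n f\<bar> = 1"
  using homeomorphic_map_nsphere_conj[OF assms] Brouwer_degree2_homeomorphic_maps
  unfolding sphere_degree_def by metis

text \<open>Degrees are integers and multiply under composition, so the factors of \<open>u\<close>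
  and \<open>v\<close> cancel.\<close>

lemma sphere_degree_conj:
  assumes "homeomorphism (fseq_sphere n) (fseq_sphere n) f f'" "homeomorphism (fseq_sphere n) (fseq_sphere n) u v"
  shows "sphere_degree n (v \<circ> (f \<circ> u)) = sphere_degree n f"
proof -
  have "sphere_degree n (v \<circ> (f \<circ> u)) = sphere_degree n v * (sphere_degree n f * sphere_degree n u)"
    using sphere_degree_compose[OF homeomorphism_compose[OF assms(2,1)] homeomorphism_symD[OF assms(2)]]
      sphere_degree_compose[OF assms(2,1)] by simp
  then show ?thesis using sphere_degree_inverse[OF assms(2)] by (simp add: ac_simps)
qed

text \<open>Two different hyperplane reflections are conjugate by a third, which swaps their unit
  normals, and conjugation preserves the degree; negating coordinate 0 is the known case.\<close>

lemma sphere_degree_reflect: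
  assumes b: "b \<in> fseq_upto n" "norm b = 1"
  shows "sphere_degree n (reflect b) = -1"
proof -
  let ?e = "fseq_basis 0"
  have e: "?e \<in> fseq_upto n" "norm ?e = 1" by (auto intro: fseq_basis_upto norm_fseq_basis)
  have base: "sphere_degree n (reflect ?e) = -1"
  proof -
    have "sphere_degree n (reflect ?e) = Brouwer_degree2 n (\<lambda>x i. if i = 0 then - x i else x i)"
      unfolding sphere_degree_def
    proof (rule Brouwer_degree2_eq, rule ext)
      fix x i assume "x \<in> topspace (nsphere n)"
      from coord_Fseq_nsphere[OF this]
      show "(coord \<circ> reflect ?e \<circ> Fseq) x i = (if i = 0 then - x i else x i)"
        by (simp add: reflect_def inner_fseq_basis coord_fseq_basis)
    qed
    then show ?thesis by (simp add: Brouwer_degree2_reflection)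
  qed
  show ?thesis
  proof (cases "b = ?e")
    case True
    then show ?thesis using base by simp
  next
    case False
    obtain w where w: "w \<in> fseq_upto n" "norm w = 1" "reflect w b = ?e"
      using reflection_swap[OF subspace_fseq_upto b(1) e(1) b(2) e(2) False] by blast
    have "reflect w (reflect b (reflect w x)) = reflect ?e x" for x
    proof -
      have lin: "reflect w (y - c *\<^sub>R z) = reflect w y - c *\<^sub>R reflect w z" for y z c
        by (simp add: reflect_def inner_diff_left algebra_simps)
      have "reflect w x \<bullet> b = x \<bullet> ?e"
        using inner_reflect[OF w(2), of x ?e] reflect_reflect[OF w(2), of b] by (simp add: w(3))
      then show ?thesis
        unfolding reflect_def[of b "reflect w x"] lin reflect_reflect[OF w(2)] w(3) by (simp add: reflect_def)
    qed
    then have "sphere_degree n (reflect w \<circ> (reflect b \<circ> reflect w)) = -1" using base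
      by (metis (no_types, lifting) comp_apply sphere_degree_cong)
    then show ?thesis
      using sphere_degree_conj[OF homeomorphism_reflect[OF subspace_fseq_upto b] homeomorphism_reflect[OF subspace_fseq_upto w(1,2)]]
      by simp
  qed
qed

theorem theorem3p1:
  fixes n :: nat
    and A Z :: "(nat \<Rightarrow> real) set"
    and \<B>A \<B>Z :: "(nat \<Rightarrow> real) set set"
    and h :: "(nat \<Rightarrow> real) \<Rightarrow> nat \<Rightarrow> real"
  assumes "n \<ge> 2"
    and "compactin (nsphere n) A" and "compactin (nsphere n) Z"
    and "nested_ball_basis n A \<B>A" and "nested_ball_basis n Z \<B>Z"
    and "homeomorphic_map (subtopology (nsphere n) A) (subtopology (nsphere n) Z) h"
  shows "(\<exists>h'. homeomorphic_map (nsphere n) (nsphere n) h' \<and> (\<forall>x\<in>A. h' x = h x)) \<and>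
         (\<exists>h'. orientation_reversing n h' \<and> (\<forall>x\<in>A. h' x = h x)) \<and>
         (\<exists>h'. orientation_preserving n h' \<and> (\<forall>x\<in>A. h' x = h x))"
proof -
  let ?T = "topspace (nsphere n)" and ?X = "fseq_sphere n"
  have AZ: "A \<subseteq> ?T" "Z \<subseteq> ?T" using assms(2,3) by (auto dest: compactin_subset_topspace)
  have comp: "compact A" "compact Z"
    using assms(2,3) AZ nsphere_eq[of n] compactin_subtopology[of euclidean ?T] by auto
  obtain k where h: "homeomorphism A Z h k"
    using assms(6) unfolding subtopology_nsphere_eq[OF AZ(1)] subtopology_nsphere_eq[OF AZ(2)]
      homeomorphic_map_maps homeomorphic_maps_top_of_set by blast
  note hX = homeomorphism_nsphere[of n]
  have hA: "homeomorphism A (Fseq ` A) Fseq coord" by (rule homeomorphism_of_subsets[OF hX AZ(1) subset_refl refl])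
  have hZ: "homeomorphism Z (Fseq ` Z) Fseq coord" by (rule homeomorphism_of_subsets[OF hX AZ(2) subset_refl refl])
  have compF: "compact (Fseq ` A)" "compact (Fseq ` Z)"
    using compact_continuous_image[OF homeomorphism_cont1[OF hA] comp(1)] compact_continuous_image[OF homeomorphism_cont1[OF hZ] comp(2)] by auto
  have subF: "Fseq ` A \<subseteq> ?X" "Fseq ` Z \<subseteq> ?X" using AZ homeomorphism_image1[OF hX] by blast+
  have h': "homeomorphism (Fseq ` A) (Fseq ` Z) (Fseq \<circ> (h \<circ> coord)) ((Fseq \<circ> k) \<circ> coord)"
    by (rule homeomorphism_compose[OF homeomorphism_compose[OF homeomorphism_symD[OF hA] h] hZ])
  \<comment> \<open>Here \<open>n \<ge> 2\<close> enters: the indices 0, 1 and 2 must not exceed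
    \<open>n\<close>.\<close>
  have e: "fseq_basis 0 \<in> fseq_upto n" "fseq_basis 1 \<in> fseq_upto n" "fseq_basis 2 \<in> fseq_upto n"
    using assms(1) by (auto intro: fseq_basis_upto)
  have orth: "fseq_basis 0 \<bullet> fseq_basis 1 = 0" "fseq_basis 0 \<bullet> fseq_basis 2 = 0" "fseq_basis 1 \<bullet> fseq_basis 2 = 0"
    by (simp_all add: inner_fseq_basis coord_fseq_basis)
  obtain f g u v b where f: "homeomorphism ?X ?X f g" "\<forall>x\<in>Fseq ` A. f x = (Fseq \<circ> (h \<circ> coord)) x"
    and u: "homeomorphism ?X ?X u v" "\<forall>x\<in>Fseq ` A. reflect b (u x) = u x" and b: "b \<in> fseq_upto n" "norm b = 1"
    by (rule extend_homeomorphism_between_cap_compacta[OF subspace_fseq_upto compact_fseq_sphere e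
          norm_fseq_basis norm_fseq_basis norm_fseq_basis orth
          compF(1) subF(1) cap_basis_of_nested_ball_basis[OF AZ(1) assms(4)]
          compF(2) subF(2) cap_basis_of_nested_ball_basis[OF AZ(2) assms(5)] h'])
  \<comment> \<open>\<open>r\<close> fixes the copy of \<open>A\<close> pointwise, since
    \<open>u\<close> moves it into the mirror of \<open>reflect b\<close>, and it has degree -1 as a
    conjugate of a reflection.\<close>
  define r where "r = v \<circ> (reflect b \<circ> u)"
  note hb = homeomorphism_reflect[OF subspace_fseq_upto b]
  have r: "homeomorphism ?X ?X r ((v \<circ> reflect b) \<circ> u)"
    unfolding r_def by (rule homeomorphism_compose[OF homeomorphism_compose[OF u(1) hb] homeomorphism_symD[OF u(1)]])
  have fr: "homeomorphism ?X ?X (f \<circ> r) (((v \<circ> reflect b) \<circ> u) \<circ> g)"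
    by (rule homeomorphism_compose[OF r f(1)])
  have deg: "sphere_degree n (f \<circ> r) = - sphere_degree n f"
    using sphere_degree_compose[OF r f(1)] sphere_degree_conj[OF hb u(1)] sphere_degree_reflect[OF b]
    by (simp add: r_def)
  have rA: "r (Fseq x) = Fseq x" if "x \<in> A" for x
  proof -
    have "Fseq x \<in> ?X" using subF(1) that by blast
    then show ?thesis using u(2) homeomorphism_apply1[OF u(1)] that by (simp add: r_def)
  qed
  have ext: "(coord \<circ> f \<circ> Fseq) x = h x" "(coord \<circ> (f \<circ> r) \<circ> Fseq) x = h x" if x: "x \<in> A" for x
  proof -
    have "h x \<in> Z" using h x by (auto simp: homeomorphism_def)
    then have "coord (f (Fseq x)) = h x"
      using bspec[OF f(2) imageI[OF x]] coord_Fseq_nsphere[OF subsetD[OF AZ(1) x]]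
        coord_Fseq_nsphere[OF subsetD[OF AZ(2)]] by simp
    then show "(coord \<circ> f \<circ> Fseq) x = h x" "(coord \<circ> (f \<circ> r) \<circ> Fseq) x = h x" using rA[OF x] by simp_all
  qed
  have hom: "homeomorphic_map (nsphere n) (nsphere n) (coord \<circ> f \<circ> Fseq)"
       "homeomorphic_map (nsphere n) (nsphere n) (coord \<circ> (f \<circ> r) \<circ> Fseq)"
    using homeomorphic_map_nsphere_conj[OF f(1)] homeomorphic_map_nsphere_conj[OF fr]
    unfolding homeomorphic_map_maps by blast+
  \<comment> \<open>The construction does not tell which orientation \<open>f\<close> has, but
    \<open>f\<close> and \<open>f \<circ> r\<close> realise both.\<close>
  have "sphere_degree n f = 1 \<or> sphere_degree n f = -1" using abs_sphere_degree[OF f(1)] by linarith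
  then show ?thesis
  proof
    assume "sphere_degree n f = 1"
    then have "orientation_preserving n (coord \<circ> f \<circ> Fseq)" "orientation_reversing n (coord \<circ> (f \<circ> r) \<circ> Fseq)"
      using hom deg by (simp_all add: orientation_preserving_def orientation_reversing_def sphere_degree_def)
    then show ?thesis using hom(1) ext by blast
  next
    assume "sphere_degree n f = -1"
    then have "orientation_reversing n (coord \<circ> f \<circ> Fseq)" "orientation_preserving n (coord \<circ> (f \<circ> r) \<circ> Fseq)"
      using hom deg by (simp_all add: orientation_preserving_def orientation_reversing_def sphere_degree_def)
    then show ?thesis using hom(1) ext by blast
  qed
qed

end
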